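(* Let $k$ be a commutative ring. There is a functor $\mathbb{W}(k):\mathcal{TP}^{TR}\to \mathrm{Set}$ sending a truncation poset $S$ to $\mathbb{W}_S(k)$, such that the composite $(\mathcal{TP}^R)^{op}\to\mathcal{TP}^{TR}\to \mathrm{Set}$ is the functor sending an $R$-map $f:S\to T$ to $f^*:\mathbb{W}_T(k)\to\mathbb{W}_S(k)$, and the composite $\mathcal{TP}^T\to\mathcal{TP}^{TR}\to \mathrm{Set}$ is the functor sending a $T$-map $f:S\to T$ to $f_\oplus:\mathbb{W}_S(k)\to\mathbb{W}_T(k)$.
   Context: $\mathbb{N}=\{1,2,\ldots\}$; partial orders are written $s\mid t$. A truncation poset is a partially ordered set $S$ with a function $|-|:S\to\mathbb{N}$ such that: (1) if $s\mid t$ then $|s|$ divides $|t|$; (2) if $d$ divides $|s|$ there is a unique $t\in S$ with $t\mid s$ and $|t|=|s|/d$; (3) for $s\in S$, $d\in\mathbb{N}$ there is at most one $t$ with $s\mid t$ and $|t|=d|s|$. A map ($R$-map) $f:S\to T$ of truncation posets is a map of sets such that $s_1\mid s_2$ implies $f(s_1)\mid f(s_2)$ and $|f(s_2)|/|f(s_1)|=|s_2|/|s_1|$. It is a $T$-map if (1) for all $s\in S$, $t'\in T$ with $f(s)\mid t'$ there is $s'\in S$ with $s\mid s'$ and $f(s')=t'$; (2) each $f^{-1}(t)$ is finite. $\mathcal{TP}^R$, $\mathcal{TP}^T$ are the corresponding categories. $\mathbb{W}_S(k)=k^S$ as a set, with ghost map $w:\mathbb{W}_S(k)\to k^S$, $(a_s)\mapsto\langle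 x_s\rangle$, $x_s=\sum_{t\mid s}|t|a_t^{|s|/|t|}$. For an $R$-map (resp. $T$-map) $f:S\to T$, $f^*:\mathbb{W}_T(k)\to\mathbb{W}_S(k)$ (resp. $f_\oplus:\mathbb{W}_S(k)\to\mathbb{W}_T(k)$) is the unique map of sets, natural in the commutative ring $k$, with $w\circ f^*=f^*_w\circ w$ (resp. $w\circ f_\oplus=f_\oplus^w\circ w$), where $(f^*_w\langle x_t\rangle)_s=x_{f(s)}$ and $(f_\oplus^w\langle x_s\rangle)_t=\sum_{s\in f^{-1}(t)}\frac{|t|}{|s|}x_s$. The category $\mathcal{TP}^{TR}$ has truncation posets as objects; a morphism $S\to T$ is an equivalence class of finite diagrams $S\to A_1\to\cdots\to A_n\to T$ in which every arrow is a morphism of $\mathcal{TP}^T$ or of $(\mathcal{TP}^R)^{op}$ (denoted $f_\oplus$, resp. $f^*:T\to S$ for an $R$-map $f:S\to T$). The equivalence relation is generated by isomorphism of diagrams, insertion of identities, composing adjacent arrows in the same one of the two categories, and the following: for a $T$-map $f:S\to A$ and an $R$-map $g:T\to A$, $g^*\circ f_\oplus=f'_\oplus\circ(g')^*$, where $f_\oplus^*T$ is the truncation poset of triples $(s,t,\xi)$ with $s\in S$, $t\in T$, $f(s)=g(t)$ and $\xi\in C_m$ (cyclic group of order $m$), $m=\gcd(|f(s)|/|s|,|g(t)|/|t|)$, with $|(s,t,\xi)|=\gcd(|s|,|t|)$ and $(s_1,t_1,\xi_1)\mid(s_2,t_2,\xi_2)$ iff $s_1\mid s_2$, $t_1\mid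 t_2$, $\xi_1=\xi_2$ (the numbers $m$ then agree), and $g':f_\oplus^*T\to S$, $f':f_\oplus^*T\to T$ are the projections. *)

theory Defs
  imports "HOL-Algebra.Ring" "HOL-Algebra.Elementary_Groups" "HOL-Library.FuncSet"
begin

section \<open>Truncation posets\<close>

record 'a tposet =
  pts :: "'a set"
  rel :: "('a \<times> 'a) set"
  nrm :: "'a \<Rightarrow> nat"

text \<open>The order is a set of pairs of points and the norm is extensional, so that two truncation
  posets are equal as soon as they have the same points, order and norm.\<close>

definition truncation_poset :: "'a tposet \<Rightarrow> bool" where
  "truncation_poset S \<longleftrightarrow>
     partial_order_on (pts S) (rel S) \<and>
     nrm S \<in> pts S \<rightarrow>\<^sub>E {1..} \<and>
     (\<forall>(s, t) \<in> rel S. nrm S s dvd nrm S t) \<and>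
     (\<forall>s \<in> pts S. \<forall>d. d dvd nrm S s \<longrightarrow>
        (\<exists>!t. t \<in> pts S \<and> (t, s) \<in> rel S \<and> nrm S t = nrm S s div d)) \<and>
     (\<forall>s \<in> pts S. \<forall>d \<ge> 1. \<exists>\<^sub>\<le>\<^sub>1 t. t \<in> pts S \<and> (s, t) \<in> rel S \<and> nrm S t = d * nrm S s)"

text \<open>In both quotients below the division is exact, because related points have
  dividing norms.\<close>

definition rmap :: "'a tposet \<Rightarrow> 'b tposet \<Rightarrow> ('a \<Rightarrow> 'b) \<Rightarrow> bool" where
  "rmap S T f \<longleftrightarrow>
     f \<in> pts S \<rightarrow>\<^sub>E pts T \<and>
     (\<forall>(s1, s2) \<in> rel S. (f s1, f s2) \<in> rel T \<and>
        nrm T (f s2) div nrm T (f s1) = nrm S s2 div nrm S s1)"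

definition tmap :: "'a tposet \<Rightarrow> 'b tposet \<Rightarrow> ('a \<Rightarrow> 'b) \<Rightarrow> bool" where
  "tmap S T f \<longleftrightarrow>
     rmap S T f \<and>
     (\<forall>s \<in> pts S. \<forall>t' \<in> pts T. (f s, t') \<in> rel T \<longrightarrow>
        (\<exists>s' \<in> pts S. (s, s') \<in> rel S \<and> f s' = t')) \<and>
     (\<forall>t \<in> pts T. finite {s \<in> pts S. f s = t})"

definition tp_id :: "'a tposet \<Rightarrow> 'a \<Rightarrow> 'a" where
  "tp_id S = (\<lambda>s \<in> pts S. s)"

definition tp_iso :: "'a tposet \<Rightarrow> 'b tposet \<Rightarrow> ('a \<Rightarrow> 'b) \<Rightarrow> bool" where
  "tp_iso S T f \<longleftrightarrow>
     rmap S T f \<and>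
     (\<exists>g. rmap T S g \<and> compose (pts S) g f = tp_id S \<and> compose (pts T) f g = tp_id T)"

text \<open>The truncation poset \<open>f\<^sub>\<oplus>\<^sup>*T\<close> for \<open>f : S \<rightarrow> A\<close> and \<open>g : T \<rightarrow> A\<close>. The divisions are exact, since
  the norm of a point divides the norm of its image under an \<open>R\<close>-map.\<close>

definition pullback ::
  "'a tposet \<Rightarrow> 'b tposet \<Rightarrow> 'c tposet \<Rightarrow> ('a \<Rightarrow> 'c) \<Rightarrow> ('b \<Rightarrow> 'c) \<Rightarrow> ('a \<times> 'b \<times> int) tposet" where
  "pullback S T A f g =
     (let P = {(s, t, x). s \<in> pts S \<and> t \<in> pts T \<and> f s = g t \<and>
                 x \<in> carrier (integer_mod_group
                        (gcd (nrm A (f s) div nrm S s) (nrm A (g t) div nrm T t)))}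
      in \<lparr>pts = P,
          rel = {((s1, t1, x1), (s2, t2, x2)).
                   (s1, t1, x1) \<in> P \<and> (s2, t2, x2) \<in> P \<and>
                   (s1, s2) \<in> rel S \<and> (t1, t2) \<in> rel T \<and> x1 = x2},
          nrm = (\<lambda>(s, t, x) \<in> P. gcd (nrm S s) (nrm T t))\<rparr>)"


section \<open>Witt vectors\<close>

text \<open>Commutative rings are records over an arbitrary carrier set, so that one can quantify over
  all commutative rings carried by subsets of a type. Both Witt vectors and ghost vectors are
  extensional functions on the points.\<close>

definition witt :: "'a tposet \<Rightarrow> 'r ring \<Rightarrow> ('a \<Rightarrow> 'r) set" where
  "witt S k = pts S \<rightarrow>\<^sub>E carrier k"

definition ghost :: "'a tposet \<Rightarrow> 'r ring \<Rightarrow> ('a \<Rightarrow> 'r) \<Rightarrow> ('a \<Rightarrow> 'r)" where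
  "ghost S k a =
     (\<lambda>s \<in> pts S. finsum k (\<lambda>t. [(nrm S t)] \<cdot>\<^bsub>k\<^esub> (a t [^]\<^bsub>k\<^esub> (nrm S s div nrm S t)))
        {t \<in> pts S. (t, s) \<in> rel S})"

definition ghost_star :: "'a tposet \<Rightarrow> 'b tposet \<Rightarrow> ('a \<Rightarrow> 'b) \<Rightarrow> ('b \<Rightarrow> 'r) \<Rightarrow> ('a \<Rightarrow> 'r)" where
  "ghost_star S T f x = (\<lambda>s \<in> pts S. x (f s))"

definition ghost_oplus ::
  "'a tposet \<Rightarrow> 'b tposet \<Rightarrow> ('a \<Rightarrow> 'b) \<Rightarrow> 'r ring \<Rightarrow> ('a \<Rightarrow> 'r) \<Rightarrow> ('b \<Rightarrow> 'r)" where
  "ghost_oplus S T f k x =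
     (\<lambda>t \<in> pts T. finsum k (\<lambda>s. [(nrm T t div nrm S s)] \<cdot>\<^bsub>k\<^esub> x s) {s \<in> pts S. f s = t})"

text \<open>Families of maps of sets from the Witt vectors over \<open>S\<close> to those over \<open>T\<close>, natural in the
  commutative ring. Ring homomorphisms act on Witt vectors coordinatewise. Extensionality makes a
  family determined by its values on Witt vectors over commutative rings.\<close>

definition natural_witt_map ::
  "'a tposet \<Rightarrow> 'b tposet \<Rightarrow> ('r ring \<Rightarrow> ('a \<Rightarrow> 'r) \<Rightarrow> ('b \<Rightarrow> 'r)) \<Rightarrow> bool" where
  "natural_witt_map S T F \<longleftrightarrow>
     F \<in> (\<Pi>\<^sub>E k \<in> {k. cring k}. witt S k \<rightarrow>\<^sub>E witt T k) \<and>
     (\<forall>k k' h. cring k \<and> cring k' \<and> h \<in> ring_hom k k' \<longrightarrow>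
        (\<forall>a \<in> witt S k. F k' (compose (pts S) h a) = compose (pts T) h (F k a)))"

text \<open>The families \<open>f\<^sup>*\<close> and \<open>f\<^sub>\<oplus>\<close>, as functions of the ring. Uniqueness of the described families
  needs the type \<open>'r\<close> to be infinite: it then carries, for each of its rings \<open>k\<close>, an isomorphic
  copy of a polynomial ring over the integers that surjects onto \<open>k\<close>.\<close>

definition star_map ::
  "'a tposet \<Rightarrow> 'b tposet \<Rightarrow> ('a \<Rightarrow> 'b) \<Rightarrow> 'r ring \<Rightarrow> ('b \<Rightarrow> 'r) \<Rightarrow> ('a \<Rightarrow> 'r)" where
  "star_map S T f =
     (THE F. natural_witt_map T S F \<and>
        (\<forall>k. cring k \<longrightarrow> (\<forall>a \<in> witt T k.
           ghost S k (F k a) = ghost_star S T f (ghost T k a))))"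

definition oplus_map ::
  "'a tposet \<Rightarrow> 'b tposet \<Rightarrow> ('a \<Rightarrow> 'b) \<Rightarrow> 'r ring \<Rightarrow> ('a \<Rightarrow> 'r) \<Rightarrow> ('b \<Rightarrow> 'r)" where
  "oplus_map S T f =
     (THE F. natural_witt_map S T F \<and>
        (\<forall>k. cring k \<longrightarrow> (\<forall>a \<in> witt S k.
           ghost T k (F k a) = ghost_oplus S T f k (ghost S k a))))"


section \<open>Categories and functors\<close>

text \<open>\<open>Comp C A B D g f\<close> is the composite of \<open>f : A \<rightarrow> B\<close> and \<open>g : B \<rightarrow> D\<close>.\<close>

record ('o, 'm) cat =
  Obj :: "'o set"
  Hom :: "'o \<Rightarrow> 'o \<Rightarrow> 'm set"
  Ident :: "'o \<Rightarrow> 'm"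
  Comp :: "'o \<Rightarrow> 'o \<Rightarrow> 'o \<Rightarrow> 'm \<Rightarrow> 'm \<Rightarrow> 'm"

definition is_category :: "('o, 'm) cat \<Rightarrow> bool" where
  "is_category C \<longleftrightarrow>
     (\<forall>A \<in> Obj C. Ident C A \<in> Hom C A A) \<and>
     (\<forall>A \<in> Obj C. \<forall>B \<in> Obj C. \<forall>D \<in> Obj C. \<forall>f \<in> Hom C A B. \<forall>g \<in> Hom C B D.
        Comp C A B D g f \<in> Hom C A D) \<and>
     (\<forall>A \<in> Obj C. \<forall>B \<in> Obj C. \<forall>f \<in> Hom C A B.
        Comp C A A B f (Ident C A) = f \<and> Comp C A B B (Ident C B) f = f) \<and>
     (\<forall>A \<in> Obj C. \<forall>B \<in> Obj C. \<forall>D \<in> Obj C. \<forall>E \<in> Obj C.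
        \<forall>f \<in> Hom C A B. \<forall>g \<in> Hom C B D. \<forall>h \<in> Hom C D E.
        Comp C A D E h (Comp C A B D g f) = Comp C A B E (Comp C B D E h g) f)"

definition op_cat :: "('o, 'm) cat \<Rightarrow> ('o, 'm) cat" where
  "op_cat C = \<lparr>Obj = Obj C, Hom = (\<lambda>A B. Hom C B A), Ident = Ident C,
     Comp = (\<lambda>A B D g f. Comp C D B A f g)\<rparr>"

record ('o, 'm, 'p, 'n) fctr =
  fobj :: "'o \<Rightarrow> 'p"
  farr :: "'o \<Rightarrow> 'o \<Rightarrow> 'm \<Rightarrow> 'n"

definition is_functor :: "('o, 'm) cat \<Rightarrow> ('p, 'n) cat \<Rightarrow> ('o, 'm, 'p, 'n) fctr \<Rightarrow> bool" where
  "is_functor C D F \<longleftrightarrow>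
     is_category C \<and> is_category D \<and>
     (\<forall>A \<in> Obj C. fobj F A \<in> Obj D) \<and>
     (\<forall>A \<in> Obj C. \<forall>B \<in> Obj C. \<forall>f \<in> Hom C A B. farr F A B f \<in> Hom D (fobj F A) (fobj F B)) \<and>
     (\<forall>A \<in> Obj C. farr F A A (Ident C A) = Ident D (fobj F A)) \<and>
     (\<forall>A \<in> Obj C. \<forall>B \<in> Obj C. \<forall>E \<in> Obj C. \<forall>f \<in> Hom C A B. \<forall>g \<in> Hom C B E.
        farr F A E (Comp C A B E g f) =
        Comp D (fobj F A) (fobj F B) (fobj F E) (farr F B E g) (farr F A B f))"

definition fctr_comp ::
  "('p, 'n, 'q, 'l) fctr \<Rightarrow> ('o, 'm, 'p, 'n) fctr \<Rightarrow> ('o, 'm, 'q, 'l) fctr" where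
  "fctr_comp G F = \<lparr>fobj = (\<lambda>A. fobj G (fobj F A)),
     farr = (\<lambda>A B f. farr G (fobj F A) (fobj F B) (farr F A B f))\<rparr>"

definition same_functor ::
  "('o, 'm) cat \<Rightarrow> ('p, 'n) cat \<Rightarrow> ('o, 'm, 'p, 'n) fctr \<Rightarrow> ('o, 'm, 'p, 'n) fctr \<Rightarrow> bool" where
  "same_functor C D F G \<longleftrightarrow>
     is_functor C D F \<and> is_functor C D G \<and>
     (\<forall>A \<in> Obj C. fobj F A = fobj G A) \<and>
     (\<forall>A \<in> Obj C. \<forall>B \<in> Obj C. \<forall>f \<in> Hom C A B. farr F A B f = farr G A B f)"

definition set_cat :: "('x set, 'x \<Rightarrow> 'x) cat" where
  "set_cat = \<lparr>Obj = UNIV, Hom = (\<lambda>X Y. X \<rightarrow>\<^sub>E Y), Ident = (\<lambda>X. \<lambda>x \<in> X. x),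
     Comp = (\<lambda>X Y Z g f. compose X g f)\<rparr>"


section \<open>The categories of truncation posets\<close>

text \<open>The type \<open>'u\<close> plays the role of the universe: the objects are all truncation posets whose
  points are elements of \<open>'u\<close>.\<close>

definition TP_R :: "('u tposet, 'u \<Rightarrow> 'u) cat" where
  "TP_R = \<lparr>Obj = {S. truncation_poset S}, Hom = (\<lambda>S T. {f. rmap S T f}), Ident = tp_id,
     Comp = (\<lambda>S T U g f. compose (pts S) g f)\<rparr>"

definition TP_T :: "('u tposet, 'u \<Rightarrow> 'u) cat" where
  "TP_T = \<lparr>Obj = {S. truncation_poset S}, Hom = (\<lambda>S T. {f. tmap S T f}), Ident = tp_id,
     Comp = (\<lambda>S T U g f. compose (pts S) g f)\<rparr>"

text \<open>\<open>TArr S T f\<close> is \<open>f\<^sub>\<oplus> : S \<rightarrow> T\<close> for a \<open>T\<close>-map \<open>f : S \<rightarrow> T\<close>, and \<open>RArr S T f\<close> is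
  \<open>f\<^sup>* : T \<rightarrow> S\<close> for an \<open>R\<close>-map \<open>f : S \<rightarrow> T\<close>.\<close>

datatype 'u arrow =
    TArr "'u tposet" "'u tposet" "'u \<Rightarrow> 'u"
  | RArr "'u tposet" "'u tposet" "'u \<Rightarrow> 'u"

fun asrc :: "'u arrow \<Rightarrow> 'u tposet" where
  "asrc (TArr S T f) = S"
| "asrc (RArr S T f) = T"

fun atgt :: "'u arrow \<Rightarrow> 'u tposet" where
  "atgt (TArr S T f) = T"
| "atgt (RArr S T f) = S"

fun arrow_ok :: "'u arrow \<Rightarrow> bool" where
  "arrow_ok (TArr S T f) \<longleftrightarrow> truncation_poset S \<and> truncation_poset T \<and> tmap S T f"
| "arrow_ok (RArr S T f) \<longleftrightarrow> truncation_poset S \<and> truncation_poset T \<and> rmap S T f"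

fun path :: "'u tposet \<Rightarrow> 'u arrow list \<Rightarrow> 'u tposet \<Rightarrow> bool" where
  "path S [] T \<longleftrightarrow> S = T"
| "path S (a # as) T \<longleftrightarrow> arrow_ok a \<and> asrc a = S \<and> path (atgt a) as T"

text \<open>A diagram from \<open>S\<close> to \<open>T\<close> lists its arrows in diagrammatic order.\<close>

definition diagrams :: "'u tposet \<Rightarrow> 'u tposet \<Rightarrow> 'u arrow list set" where
  "diagrams S T = {d. d \<noteq> [] \<and> path S d T}"

text \<open>\<open>arrow_iso p a b q\<close>: the arrows \<open>a\<close> and \<open>b\<close> are of the same kind and the isomorphisms \<open>p\<close>, \<open>q\<close>
  of their sources and targets form a commutative square with them.\<close>

fun arrow_iso :: "('u \<Rightarrow> 'u) \<Rightarrow> 'u arrow \<Rightarrow> 'u arrow \<Rightarrow> ('u \<Rightarrow> 'u) \<Rightarrow> bool" where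
  "arrow_iso p (TArr S T f) (TArr S' T' f') q \<longleftrightarrow>
     tp_iso S S' p \<and> tp_iso T T' q \<and> (\<forall>s \<in> pts S. q (f s) = f' (p s))"
| "arrow_iso p (RArr S T f) (RArr S' T' f') q \<longleftrightarrow>
     tp_iso T T' p \<and> tp_iso S S' q \<and> (\<forall>s \<in> pts S. p (f s) = f' (q s))"
| "arrow_iso p _ _ q \<longleftrightarrow> False"

inductive diag_iso ::
  "('u \<Rightarrow> 'u) \<Rightarrow> 'u arrow list \<Rightarrow> 'u arrow list \<Rightarrow> ('u \<Rightarrow> 'u) \<Rightarrow> bool" where
  single: "arrow_iso p a b q \<Longrightarrow> diag_iso p [a] [b] q"
| cons: "arrow_iso p a b q \<Longrightarrow> diag_iso q as bs r \<Longrightarrow> diag_iso p (a # as) (b # bs) r"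

text \<open>The generating moves. An isomorphism of diagrams from \<open>S\<close> to \<open>T\<close> is the identity at both ends.
  The rule \<open>exchange\<close> allows any truncation poset \<open>P\<close> in the universe that is isomorphic to the
  pullback, since the latter has points in another type; if \<open>'u\<close> is infinite such a \<open>P\<close> always
  exists.\<close>

inductive diag_move ::
  "'u tposet \<Rightarrow> 'u tposet \<Rightarrow> 'u arrow list \<Rightarrow> 'u arrow list \<Rightarrow> bool"
  for S T :: "'u tposet" where
  iso: "diag_iso (tp_id S) d e (tp_id T) \<Longrightarrow> diag_move S T d e"
| ident_T: "diag_move S T (d @ e) (d @ [TArr A A (tp_id A)] @ e)"
| ident_R: "diag_move S T (d @ e) (d @ [RArr A A (tp_id A)] @ e)"
| comp_T: "diag_move S T (d @ [TArr A B f, TArr B C g] @ e)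
                         (d @ [TArr A C (compose (pts A) g f)] @ e)"
| comp_R: "diag_move S T (d @ [RArr B C g, RArr A B f] @ e)
                         (d @ [RArr A C (compose (pts A) g f)] @ e)"
| exchange: "tp_iso P (pullback X Y A f g) p \<Longrightarrow>
     diag_move S T (d @ [TArr X A f, RArr Y A g] @ e)
                   (d @ [RArr P X (\<lambda>z \<in> pts P. fst (p z)),
                         TArr P Y (\<lambda>z \<in> pts P. fst (snd (p z)))] @ e)"

definition diag_rel :: "'u tposet \<Rightarrow> 'u tposet \<Rightarrow> 'u arrow list rel" where
  "diag_rel S T = {(d, e). d \<in> diagrams S T \<and> e \<in> diagrams S T \<and>
     equivclp (\<lambda>x y. x \<in> diagrams S T \<and> y \<in> diagrams S T \<and> diag_move S T x y) d e}"

definition diag_class :: "'u tposet \<Rightarrow> 'u tposet \<Rightarrow> 'u arrow list \<Rightarrow> 'u arrow list set" where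
  "diag_class S T d = diag_rel S T `` {d}"

definition TP_TR :: "('u tposet, 'u arrow list set) cat" where
  "TP_TR = \<lparr>Obj = {S. truncation_poset S},
     Hom = (\<lambda>S T. diagrams S T // diag_rel S T),
     Ident = (\<lambda>S. diag_class S S [TArr S S (tp_id S)]),
     Comp = (\<lambda>S T U G F. \<Union>d \<in> F. \<Union>e \<in> G. diag_class S U (d @ e))\<rparr>"

text \<open>The canonical functors from \<open>TP_T\<close> and from the opposite of \<open>TP_R\<close>. In the latter an arrow
  from \<open>T\<close> to \<open>S\<close> is an \<open>R\<close>-map from \<open>S\<close> to \<open>T\<close>.\<close>

definition incl_T :: "('u tposet, 'u \<Rightarrow> 'u, 'u tposet, 'u arrow list set) fctr" where
  "incl_T = \<lparr>fobj = (\<lambda>S. S), farr = (\<lambda>S T f. diag_class S T [TArr S T f])\<rparr>"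

definition incl_R :: "('u tposet, 'u \<Rightarrow> 'u, 'u tposet, 'u arrow list set) fctr" where
  "incl_R = \<lparr>fobj = (\<lambda>S. S), farr = (\<lambda>T S f. diag_class T S [RArr S T f])\<rparr>"

definition witt_star ::
  "'r ring \<Rightarrow> ('u tposet, 'u \<Rightarrow> 'u, ('u \<Rightarrow> 'r) set, ('u \<Rightarrow> 'r) \<Rightarrow> ('u \<Rightarrow> 'r)) fctr" where
  "witt_star k = \<lparr>fobj = (\<lambda>S. witt S k), farr = (\<lambda>T S f. star_map S T f k)\<rparr>"

definition witt_oplus ::
  "'r ring \<Rightarrow> ('u tposet, 'u \<Rightarrow> 'u, ('u \<Rightarrow> 'r) set, ('u \<Rightarrow> 'r) \<Rightarrow> ('u \<Rightarrow> 'r)) fctr" where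
  "witt_oplus k = \<lparr>fobj = (\<lambda>S. witt S k), farr = (\<lambda>S T f. oplus_map S T f k)\<rparr>"

end

theory Submission
  imports Defs "HOL-Algebra.Algebraic_Closure_Type" "HOL-Library.Poly_Mapping" "HOL-Library.Countable"
begin

text \<open>The ghost map is injective over a torsion-free ring, and every commutative ring is a quotient
  of a polynomial ring over the integers. A natural map of Witt vectors is therefore determined by
  its effect on ghost vectors. Over a polynomial ring, Dwork's lemma describes the ghost vectors of
  Witt vectors by the congruences \<open>x\<^sub>s \<equiv> \<phi>\<^sub>p(x\<^sub>s\<^sub>/\<^sub>p)\<close> modulo the exact power of \<open>p\<close> dividing \<open>|s|\<close>;
  both ghost maps \<open>f\<^sup>*\<close> and \<open>f\<^sub>\<oplus>\<close> preserve these, which gives existence. A diagram acts on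
  Witt vectors by composing its arrows, and by uniqueness the equivalence relation on diagrams need
  only be respected on ghost vectors. There the only relation with content is the exchange rule,
  which is the identity \<open>m \<cdot> |t| / gcd(|s|, |t|) = |g(t)| / |s|\<close> for the number \<open>m\<close> of points of the
  pullback over \<open>(s, t)\<close>.\<close>

section \<open>Integer polynomials and lifts of Frobenius\<close>

text \<open>The theorem fixes one ring \<open>k\<close>, but the ghost map over \<open>k\<close> may
  fail to be injective, for instance when a prime vanishes in \<open>k\<close>. Arrows and diagrams
  are therefore treated as families over all commutative rings of type \<open>'r ring\<close>,
  compared there, and only then specialised to \<open>k\<close>. On ghost vectors the moves hold for
  every vector over every ring, whether or not it comes from a Witt vector, so Dwork's lemma is
  needed only to construct the lifts of single arrows. Types shape the rest. The generic Witt vector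
  has variables indexed by points, so its ring lies outside \<open>'r\<close>; existence pairs a
  ghost map on rings over \<open>'r\<close> with a polynomial counterpart, linked by naturality. The
  pullback too has points in a new type. It is never shown to be a truncation poset: only
  divisibility of norms along its order and a point of norm 1 below each point are established,
  enough to transfer norms to the isomorphic \<open>P\<close>.\<close>

text \<open>Multisets of variables serve as monomials.\<close>

type_synonym 'x zpoly = "'x multiset \<Rightarrow>\<^sub>0 int"

abbreviation zring :: "'x zpoly ring" where
  "zring \<equiv> ring_of_type_algebra"

definition zvar :: "'x \<Rightarrow> 'x zpoly" where
  "zvar x = Poly_Mapping.single {#x#} 1"

text \<open>Monomials are products of variables, 0 is 1 - 1, and \<open>frag_induction\<close>
  builds integer combinations from differences. Comparing ring homomorphisms, or proving the
  Frobenius congruence, then comes down to the variables.\<close>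

lemma zpoly_induct [case_names one var diff mult]:
  assumes one: "P 1"
    and var: "\<And>x. P (zvar x)"
    and diff: "\<And>f g. P f \<Longrightarrow> P g \<Longrightarrow> P (f - g)"
    and mult: "\<And>f g. P f \<Longrightarrow> P g \<Longrightarrow> P (f * g)"
  shows "P f"
proof -
  have zero: "P 0"
    using diff[OF one one] by simp
  have mon: "P (frag_of m)" for m
  proof (induction m)
    case (add x m)
    have "frag_of (add_mset x m) = zvar x * frag_of m"
      by (simp add: zvar_def mult_single)
    then show ?case using mult[OF var add] by simp
  qed (use one in simp)
  show ?thesis
    by (rule frag_induction[of f UNIV]) (use zero mon diff in auto)
qed

section \<open>Evaluation of integer polynomials in a commutative ring\<close>

definition mon_eval :: "'r ring \<Rightarrow> ('x \<Rightarrow> 'r) \<Rightarrow> 'x multiset \<Rightarrow> 'r" where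
  "mon_eval k a m = finprod k (\<lambda>x. a x [^]\<^bsub>k\<^esub> count m x) (set_mset m)"

definition zpoly_eval :: "'r ring \<Rightarrow> ('x \<Rightarrow> 'r) \<Rightarrow> 'x zpoly \<Rightarrow> 'r" where
  "zpoly_eval k a f =
     finsum k (\<lambda>m. [Poly_Mapping.lookup f m] \<cdot>\<^bsub>k\<^esub> mon_eval k a m) (Poly_Mapping.keys f)"

context
  fixes k :: "'r ring" (structure) and a :: "'x \<Rightarrow> 'r"
  assumes k: "cring k" and a: "\<And>x. a x \<in> carrier k"
begin

interpretation cring k by (rule k)

text \<open>The added factors are zeroth powers. A common index set lets two monomials with
  different supports be multiplied factor by factor.\<close>

lemma mon_eval_superset:
  "finite A \<Longrightarrow> set_mset m \<subseteq> A \<Longrightarrow> mon_eval k a m = finprod k (\<lambda>x. a x [^] count m x) A"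
  unfolding mon_eval_def
  by (rule finprod_mono_neutral_cong_left) (auto simp: a not_in_iff)

lemma mon_eval_closed: "mon_eval k a m \<in> carrier k"
  unfolding mon_eval_def using a by (auto intro!: finprod_closed)

lemma mon_eval_add: "mon_eval k a (m + n) = mon_eval k a m \<otimes> mon_eval k a n"
proof -
  let ?A = "set_mset m \<union> set_mset n"
  have "mon_eval k a (m + n) =
      finprod k (\<lambda>x. a x [^] count m x \<otimes> a x [^] count n x) ?A"
    using a by (subst mon_eval_superset[of ?A]) (auto simp: nat_pow_mult)
  also have "\<dots> = finprod k (\<lambda>x. a x [^] count m x) ?A \<otimes>
      finprod k (\<lambda>x. a x [^] count n x) ?A"
    using a by (intro finprod_multf) auto
  also have "\<dots> = mon_eval k a m \<otimes> mon_eval k a n"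
    by (subst (1 2) mon_eval_superset[of ?A]) auto
  finally show ?thesis .
qed

lemma zpoly_eval_superset:
  "finite A \<Longrightarrow> Poly_Mapping.keys f \<subseteq> A \<Longrightarrow>
    zpoly_eval k a f = finsum k (\<lambda>m. [Poly_Mapping.lookup f m] \<cdot> mon_eval k a m) A"
  unfolding zpoly_eval_def
  by (rule add.finprod_mono_neutral_cong_left)
    (auto simp: mon_eval_closed in_keys_iff add_pow_int_ge)

lemma zpoly_eval_closed: "zpoly_eval k a f \<in> carrier k"
  unfolding zpoly_eval_def using mon_eval_closed by (auto intro!: finsum_closed)

lemma zpoly_eval_add: "zpoly_eval k a (f + g) = zpoly_eval k a f \<oplus> zpoly_eval k a g"
proof -
  let ?A = "Poly_Mapping.keys f \<union> Poly_Mapping.keys g"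
  have "zpoly_eval k a (f + g) = finsum k (\<lambda>m. [Poly_Mapping.lookup f m] \<cdot> mon_eval k a m \<oplus>
      [Poly_Mapping.lookup g m] \<cdot> mon_eval k a m) ?A"
    by (subst zpoly_eval_superset[of ?A])
      (auto simp: Poly_Mapping.keys_add lookup_add add.int_pow_mult mon_eval_closed)
  also have "\<dots> = finsum k (\<lambda>m. [Poly_Mapping.lookup f m] \<cdot> mon_eval k a m) ?A \<oplus>
      finsum k (\<lambda>m. [Poly_Mapping.lookup g m] \<cdot> mon_eval k a m) ?A"
    using mon_eval_closed by (intro finsum_addf) auto
  also have "\<dots> = zpoly_eval k a f \<oplus> zpoly_eval k a g"
    by (subst (1 2) zpoly_eval_superset[of ?A]) auto
  finally show ?thesis .
qed

lemma zpoly_eval_diff: "zpoly_eval k a (f - g) = zpoly_eval k a f \<ominus> zpoly_eval k a g"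
  using zpoly_eval_add[of "f - g" g] zpoly_eval_closed
  by (simp add: a_minus_def add.inv_solve_right)

lemma zpoly_eval_frag: "zpoly_eval k a (frag_of m) = mon_eval k a m"
  using mon_eval_closed by (subst zpoly_eval_superset[of "{m}"]) auto

lemma zpoly_eval_zero: "zpoly_eval k a 0 = \<zero>"
  by (simp add: zpoly_eval_def)

text \<open>Both sides are additive in \<open>f\<close> and in \<open>g\<close>, so two nested
  inductions over integer combinations leave only a product of two monomials.\<close>

lemma zpoly_eval_mult: "zpoly_eval k a (f * g) = zpoly_eval k a f \<otimes> zpoly_eval k a g"
proof (induction f rule: frag_induction[OF subset_UNIV])
  case (2 m)
  show ?case
  proof (induction g rule: frag_induction[OF subset_UNIV])
    case (2 n)
    then show ?case
      by (simp add: mult_single zpoly_eval_frag mon_eval_add)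
  next
    case (3 g h)
    then show ?case
      by (simp add: right_diff_distrib zpoly_eval_diff zpoly_eval_closed a_minus_def r_distr r_minus)
  qed (simp add: zpoly_eval_zero zpoly_eval_closed)
next
  case (3 f h)
  then show ?case
    by (simp add: left_diff_distrib zpoly_eval_diff zpoly_eval_closed a_minus_def l_distr l_minus)
qed (simp add: zpoly_eval_zero zpoly_eval_closed)

lemma zpoly_eval_one: "zpoly_eval k a 1 = \<one>"
  using zpoly_eval_frag[of "{#}"] mon_eval_closed[of "{#}"] by (simp add: mon_eval_def)

lemma zpoly_eval_zvar: "zpoly_eval k a (zvar x) = a x"
  using a mon_eval_closed[of "{#x#}"] by (simp add: zvar_def zpoly_eval_frag mon_eval_def)

lemma zpoly_eval_hom: "zpoly_eval k a \<in> ring_hom zring k"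
  by (rule ring_hom_memI)
    (auto simp: zpoly_eval_closed zpoly_eval_add zpoly_eval_mult zpoly_eval_one
      ring_of_type_algebra_def)

end

section \<open>Type-class rings read as ring records\<close>

lemma ring_of_type_algebra_simps [simp]:
  fixes x y :: "'p :: comm_ring_1"
  shows "carrier (ring_of_type_algebra :: 'p ring) = UNIV"
    and "x \<otimes>\<^bsub>ring_of_type_algebra\<^esub> y = x * y"
    and "x \<oplus>\<^bsub>ring_of_type_algebra\<^esub> y = x + y"
    and "\<one>\<^bsub>ring_of_type_algebra\<^esub> = (1 :: 'p)"
    and "\<zero>\<^bsub>ring_of_type_algebra\<^esub> = (0 :: 'p)"
  by (simp_all add: ring_of_type_algebra_def)

lemma ring_of_type_algebra_pow [simp]:
  "(x :: 'p :: comm_ring_1) [^]\<^bsub>ring_of_type_algebra\<^esub> (n::nat) = x ^ n"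
  by (induction n) (simp_all add: nat_pow_def mult.commute)

lemma ring_of_type_algebra_add_pow [simp]:
  "[(n::nat)] \<cdot>\<^bsub>ring_of_type_algebra\<^esub> (x :: 'p :: comm_ring_1) = of_nat n * x"
  by (induction n) (simp_all add: add_pow_def nat_pow_def algebra_simps)

lemma ring_of_type_algebra_minus [simp]:
  "x \<ominus>\<^bsub>ring_of_type_algebra\<^esub> y = x - (y :: 'p :: comm_ring_1)"
proof -
  interpret cring "ring_of_type_algebra :: 'p ring" by blast
  have "x - y \<oplus>\<^bsub>ring_of_type_algebra\<^esub> y = x" by simp
  then show ?thesis
    by (metis (no_types) a_minus_def add.inv_solve_right iso_tuple_UNIV_I
        ring_of_type_algebra_simps(1))
qed

lemma ring_of_type_algebra_finsum [simp]:
  "finsum ring_of_type_algebra g A = sum (g :: _ \<Rightarrow> 'p :: comm_ring_1) A"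
proof -
  interpret cring "ring_of_type_algebra :: 'p ring" by blast
  show ?thesis
    by (induction A rule: infinite_finite_induct) simp_all
qed

text \<open>Uniqueness in the universal property of the polynomial ring, evaluation being existence.
  Naturality of lifts rests on it.\<close>

lemma zpoly_hom_eqI:
  assumes "cring k" "g \<in> ring_hom zring k" "h \<in> ring_hom zring k"
    and var: "\<And>x. g (zvar x) = h (zvar x)"
  shows "g f = h f"
proof -
  interpret g: ring_hom_cring zring k g
    using assms by (auto intro!: ring_hom_cring.intro ring_hom_cring_axioms.intro)
  interpret h: ring_hom_cring zring k h
    using assms by (auto intro!: ring_hom_cring.intro ring_hom_cring_axioms.intro)
  show ?thesis
  proof (induction f rule: zpoly_induct)
    case (diff p q)
    then show ?case
      using g.hom_sub[of p q] h.hom_sub[of p q] by simp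
  next
    case (mult p q)
    then show ?case
      using g.hom_mult[of p q] h.hom_mult[of p q] by simp
  qed (use var g.hom_one h.hom_one in auto)
qed

lemma zring_cring: "cring (zring :: 'x zpoly ring)"
  by blast

section \<open>Torsion-freeness and congruences modulo prime powers\<close>

lemma lookup_of_nat_mult:
  "Poly_Mapping.lookup (of_nat n * (f :: 'x zpoly)) m = int n * Poly_Mapping.lookup f m"
  by (induction n) (simp_all add: lookup_add algebra_simps)

lemma zpoly_torsion_free:
  assumes "n > 0" "of_nat n * f = (0 :: 'x zpoly)"
  shows "f = 0"
  using assms lookup_of_nat_mult[of n f] by (intro poly_mapping_eqI) auto

lemma dvd_power_diff: "x - y dvd x ^ n - (y :: 'p :: comm_ring_1) ^ n"
  by (metis dvd_triv_left power_diff_sumr2)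

lemma prime_dvd_add_power:
  fixes x y :: "'p :: comm_ring_1"
  assumes "prime p"
  shows "of_nat p dvd (x + y) ^ p - (x ^ p + y ^ p)"
proof -
  have p: "p > 0" using assms prime_gt_0_nat by blast
  have "{..p} = insert 0 (insert p {0<..<p})" using p by auto
  then have "(x + y) ^ p - (x ^ p + y ^ p) =
      (\<Sum>k\<in>{0<..<p}. of_nat (p choose k) * x ^ k * y ^ (p - k))"
    using p by (simp add: binomial_ring)
  also have "of_nat p dvd \<dots>"
  proof (rule dvd_sum)
    fix k assume "k \<in> {0<..<p}"
    then have "p dvd p choose k"
      using assms by (auto intro!: dvd_choose_prime)
    then have "of_nat p dvd (of_nat (p choose k) :: 'p)"
      by (auto elim!: dvdE)
    then show "of_nat p dvd of_nat (p choose k) * x ^ k * y ^ (p - k)"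
      by (intro dvd_mult2)
  qed
  finally show ?thesis .
qed

text \<open>Each further power gains a factor \<open>p\<close>: \<open>a ^ p - b ^ p\<close> is
  \<open>a - b\<close> times a sum of \<open>p\<close> terms, all of them equal to
  \<open>b ^ (p - 1)\<close> modulo \<open>p\<close>, so the sum vanishes modulo
  \<open>p\<close>.\<close>

lemma prime_power_dvd_power_diff:
  fixes x y :: "'p :: comm_ring_1"
  assumes "of_nat p dvd x - y"
  shows "of_nat (p ^ Suc j) dvd x ^ (p ^ j) - y ^ (p ^ j)"
proof (induction j)
  case (Suc j)
  define a b where "a = x ^ (p ^ j)" and "b = y ^ (p ^ j)"
  have p: "of_nat p dvd a - b"
    using assms dvd_power_diff dvd_trans unfolding a_def b_def by blast
  have "(\<Sum>i<p. b ^ (p - Suc i) * a ^ i) =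
      (\<Sum>i<p. b ^ (p - Suc i) * (a ^ i - b ^ i)) + (\<Sum>i<p. b ^ (p - 1))"
    unfolding sum.distrib[symmetric]
    by (intro sum.cong) (auto simp: algebra_simps simp flip: power_add)
  moreover have "of_nat p dvd (\<Sum>i<p. b ^ (p - Suc i) * (a ^ i - b ^ i))"
    by (intro dvd_sum dvd_mult dvd_trans[OF p dvd_power_diff])
  ultimately have "of_nat p dvd (\<Sum>i<p. b ^ (p - Suc i) * a ^ i)"
    by simp
  then have "of_nat (p ^ Suc j) * of_nat p dvd (a - b) * (\<Sum>i<p. b ^ (p - Suc i) * a ^ i)"
    using Suc unfolding a_def b_def by (intro mult_dvd_mono)
  then have "of_nat (p ^ Suc (Suc j)) dvd a ^ p - b ^ p"
    by (simp add: power_diff_sumr2[of a p b] ac_simps)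
  then show ?case
    by (simp add: a_def b_def mult.commute flip: power_mult)
qed (use assms in simp)

text \<open>Collects all that Dwork's lemma uses about the polynomial ring. At a prime the last
  axiom says that \<open>\<phi> p\<close> lifts the Frobenius map modulo \<open>p\<close>.\<close>

locale frobenius_lifts =
  fixes \<phi> :: "nat \<Rightarrow> 'p :: comm_ring_1 \<Rightarrow> 'p"
  assumes add: "\<phi> p (x + y) = \<phi> p x + \<phi> p y"
    and mult: "\<phi> p (x * y) = \<phi> p x * \<phi> p y"
    and one: "\<phi> p 1 = 1"
    and dvd: "prime p \<Longrightarrow> of_nat p dvd \<phi> p x - x ^ p"
begin

lemma zero: "\<phi> p 0 = 0"
  using add[of p 0 0] by simp

lemma of_nat: "\<phi> p (of_nat n) = of_nat n"
  by (induction n) (simp_all add: zero add one)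

lemma power: "\<phi> p (x ^ n) = \<phi> p x ^ n"
  by (induction n) (simp_all add: mult one)

lemma sum: "\<phi> p (sum g A) = (\<Sum>i\<in>A. \<phi> p (g i))"
  by (induction A rule: infinite_finite_induct) (simp_all add: zero add)

text \<open>Write \<open>m = p ^ j * n\<close> with \<open>j\<close> the multiplicity. Raising the
  Frobenius congruence to the power \<open>p ^ j\<close> sharpens the modulus to
  \<open>p ^ Suc j\<close>, and a further power \<open>n\<close> keeps it. The extra factor makes up
  for the factor \<open>p\<close> lost in passing from a point to its quotient by
  \<open>p\<close>.\<close>

lemma dvd_power:
  assumes p: "prime p" and m: "m > 0"
  shows "of_nat (p ^ Suc (multiplicity p m)) dvd \<phi> p x ^ m - x ^ (p * m)"
proof -
  define j where "j = multiplicity p m"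
  obtain n where n: "m = p ^ j * n"
    using multiplicity_dvd[of p m] unfolding j_def by (auto elim: dvdE)
  have "of_nat (p ^ Suc j) dvd \<phi> p x ^ (p ^ j) - (x ^ p) ^ (p ^ j)"
    by (rule prime_power_dvd_power_diff[OF dvd[OF p]])
  also have "\<dots> dvd (\<phi> p x ^ (p ^ j)) ^ n - ((x ^ p) ^ (p ^ j)) ^ n"
    by (rule dvd_power_diff)
  finally show ?thesis
    unfolding j_def[symmetric] by (simp add: n power_mult)
qed

end

definition zfrob :: "nat \<Rightarrow> 'x zpoly \<Rightarrow> 'x zpoly" where
  "zfrob n = zpoly_eval zring (\<lambda>x. zvar x ^ n)"

lemma zfrob_hom: "zfrob n \<in> ring_hom zring zring"
  unfolding zfrob_def by (rule zpoly_eval_hom[OF zring_cring]) simp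

lemma zfrob_zvar: "zfrob n (zvar x) = zvar x ^ n"
  unfolding zfrob_def by (rule zpoly_eval_zvar[OF zring_cring]) simp

interpretation zfrob: frobenius_lifts "zfrob :: nat \<Rightarrow> 'x zpoly \<Rightarrow> 'x zpoly"
proof
  fix p :: nat and x y :: "'x zpoly"
  show add: "zfrob p (x + y) = zfrob p x + zfrob p y"
    and mult: "zfrob p (x * y) = zfrob p x * zfrob p y" for p and x y :: "'x zpoly"
    using ring_hom_add[OF zfrob_hom, of x y p] ring_hom_mult[OF zfrob_hom, of x y p] by simp_all
  show one: "zfrob p (1 :: 'x zpoly) = 1" for p
    using ring_hom_one[OF zfrob_hom, of p] by simp
  assume p: "prime p"
  show "of_nat p dvd zfrob p x - x ^ p"
  proof (induction x rule: zpoly_induct)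
    case (diff f g)
    \<comment> \<open>Reading \<open>f\<close> as \<open>(f - g) + g\<close> brings in the binomial
      congruence for sums and avoids the sign of \<open>(- g) ^ p\<close>, which depends on the
      parity of \<open>p\<close>.\<close>
    have "zfrob p (f - g) - (f - g) ^ p =
        (zfrob p f - f ^ p) - (zfrob p g - g ^ p) + (((f - g) + g) ^ p - ((f - g) ^ p + g ^ p))"
      using add[of p "f - g" g] by (simp add: algebra_simps)
    then show ?case
      using diff prime_dvd_add_power[OF p] by (metis dvd_add dvd_diff)
  next
    case (mult f g)
    have "zfrob p (f * g) - (f * g) ^ p =
        (zfrob p f - f ^ p) * zfrob p g + f ^ p * (zfrob p g - g ^ p)"
      by (simp add: \<open>\<And>y x p. zfrob p (x * y) = zfrob p x * zfrob p y\<close> algebra_simps power_mult_distrib)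
    then show ?case
      using mult by simp
  qed (simp_all add: one zfrob_zvar)
qed

section \<open>Dwork's lemma\<close>

definition below :: "'a tposet \<Rightarrow> 'a \<Rightarrow> 'a set" where
  "below S s = {t \<in> pts S. (t, s) \<in> rel S}"

locale tposet =
  fixes S :: "'a tposet"
  assumes truncation_poset: "truncation_poset S"
begin

lemma rel_pts: "(s, t) \<in> rel S \<Longrightarrow> s \<in> pts S \<and> t \<in> pts S"
  using truncation_poset
  unfolding truncation_poset_def partial_order_on_def preorder_on_def by blast

lemma rel_refl: "s \<in> pts S \<Longrightarrow> (s, s) \<in> rel S"
  using truncation_poset
  unfolding truncation_poset_def partial_order_on_def preorder_on_def refl_on_def by blast

lemma rel_trans: "(s, t) \<in> rel S \<Longrightarrow> (t, u) \<in> rel S \<Longrightarrow> (s, u) \<in> rel S"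
  using truncation_poset
  unfolding truncation_poset_def partial_order_on_def preorder_on_def by (blast dest: transD)

lemma nrm_pos: "s \<in> pts S \<Longrightarrow> nrm S s > 0"
  using truncation_poset unfolding truncation_poset_def by (fastforce simp: PiE_iff)

lemma rel_dvd: "(s, t) \<in> rel S \<Longrightarrow> nrm S s dvd nrm S t"
  using truncation_poset unfolding truncation_poset_def by blast

text \<open>The axiom prescribes the quotient \<open>d\<close>, this form the norm \<open>n\<close>;
  replacing \<open>n\<close> by \<open>nrm S s div n\<close> exchanges the two.\<close>

lemma ex_below:
  assumes "s \<in> pts S" "n dvd nrm S s"
  shows "\<exists>t. (t, s) \<in> rel S \<and> nrm S t = n"
proof -
  have "nrm S s div n dvd nrm S s" "nrm S s div (nrm S s div n) = n"
    using assms nrm_pos[OF assms(1)] by (auto elim!: dvdE)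
  then show ?thesis
    using truncation_poset assms unfolding truncation_poset_def by metis
qed

lemma below_unique:
  assumes "(t, s) \<in> rel S" "(t', s) \<in> rel S" "nrm S t = nrm S t'"
  shows "t = t'"
proof -
  have s: "s \<in> pts S" "t \<in> pts S" "t' \<in> pts S" using assms rel_pts by auto
  have d: "nrm S s div nrm S t dvd nrm S s" "nrm S s div (nrm S s div nrm S t) = nrm S t"
    using rel_dvd[OF assms(1)] nrm_pos[OF s(1)] by (auto elim!: dvdE)
  then have "\<exists>!u. u \<in> pts S \<and> (u, s) \<in> rel S \<and> nrm S u = nrm S s div (nrm S s div nrm S t)"
    using truncation_poset s(1) unfolding truncation_poset_def by blast
  then show ?thesis using assms s d(2) by metis
qed

lemma above_unique:
  assumes "(s, t) \<in> rel S" "(s, t') \<in> rel S" "nrm S t = nrm S t'"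
  shows "t = t'"
proof -
  have s: "s \<in> pts S" "t \<in> pts S" "t' \<in> pts S" using assms rel_pts by auto
  define d where "d = nrm S t div nrm S s"
  have d: "nrm S t = d * nrm S s" "d \<ge> 1"
    using rel_dvd[OF assms(1)] nrm_pos[OF s(2)] by (auto simp: d_def elim!: dvdE)
  then have "\<exists>\<^sub>\<le>\<^sub>1 u. u \<in> pts S \<and> (s, u) \<in> rel S \<and> nrm S u = d * nrm S s"
    using truncation_poset s(1) unfolding truncation_poset_def by blast
  then show ?thesis using assms s d(1) by (auto dest: Uniq_D)
qed

lemma mem_below_iff: "t \<in> below S s \<longleftrightarrow> (t, s) \<in> rel S"
  using rel_pts by (auto simp: below_def)

text \<open>The norm embeds the points below \<open>s\<close> into the finitely many divisors of
  \<open>nrm S s\<close>.\<close>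

lemma finite_below:
  assumes "s \<in> pts S"
  shows "finite (below S s)"
proof (rule finite_imageD)
  have "nrm S ` below S s \<subseteq> {n. n dvd nrm S s}"
    using rel_dvd by (auto simp: below_def)
  then show "finite (nrm S ` below S s)"
    using nrm_pos[OF assms] by (intro finite_subset[OF _ finite_divisors_nat])
  show "inj_on (nrm S) (below S s)"
    using below_unique by (auto simp: mem_below_iff inj_on_def)
qed

lemma nrm_less: "(t, s) \<in> rel S \<Longrightarrow> t \<noteq> s \<Longrightarrow> nrm S t < nrm S s"
  using below_unique[of t s s] rel_refl rel_pts rel_dvd nrm_pos
  by (metis dvd_imp_le le_neq_implies_less)

text \<open>Below a fixed \<open>s\<close> a point is determined by its norm, so the order there is
  divisibility of norms: the point below \<open>u\<close> with the norm of \<open>t\<close> must be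
  \<open>t\<close>.\<close>

lemma below_eq:
  assumes u: "(u, s) \<in> rel S"
  shows "below S u = {t \<in> below S s. nrm S t dvd nrm S u}"
proof (intro equalityI subsetI)
  fix t assume "t \<in> {t \<in> below S s. nrm S t dvd nrm S u}"
  then have t: "(t, s) \<in> rel S" "nrm S t dvd nrm S u" by (auto simp: mem_below_iff)
  obtain t' where t': "(t', u) \<in> rel S" "nrm S t' = nrm S t"
    using ex_below t(2) rel_pts[OF u] by blast
  with t(1) u have "t' = t" using below_unique rel_trans by metis
  with t'(1) show "t \<in> below S u" by (simp add: mem_below_iff)
qed (use u rel_trans rel_dvd in \<open>auto simp: mem_below_iff\<close>)

end

lemma ghost_type_algebra:
  fixes a :: "'a \<Rightarrow> 'p :: comm_ring_1"
  shows "ghost S ring_of_type_algebra a =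
    (\<lambda>s\<in>pts S. \<Sum>t\<in>below S s. of_nat (nrm S t) * a t ^ (nrm S s div nrm S t))"
  by (simp add: ghost_def below_def)

lemma of_nat_dvd_of_nat: "m dvd n \<Longrightarrow> of_nat m dvd (of_nat n :: 'p :: comm_ring_1)"
  by (metis dvd_def of_nat_mult)

text \<open>Bezout takes the place of unique factorisation. If \<open>n = q * m\<close> with coprime
  factors, \<open>x\<close> is an integer combination of \<open>q * x\<close> and
  \<open>m * x\<close>, and each is a multiple of \<open>n\<close> because the complementary factor
  divides \<open>x\<close>.\<close>

lemma of_nat_dvd_if_prime_powers_dvd:
  fixes x :: "'p :: comm_ring_1"
  assumes "n > 0" "\<And>p. prime p \<Longrightarrow> p dvd n \<Longrightarrow> of_nat (p ^ multiplicity p n) dvd x"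
  shows "of_nat n dvd x"
  using assms
proof (induction n rule: less_induct)
  case (less n)
  show ?case
  proof (cases "n = 1")
    case False
    then obtain p where p: "prime p" "p dvd n"
      using prime_factor_nat by blast
    define q where "q = p ^ multiplicity p n"
    obtain m where m: "n = q * m" "\<not> p dvd m"
      using multiplicity_decompose'[of n p] less.prems(1) p(1) unfolding q_def
      by (metis less_irrefl not_prime_unit)
    have m0: "m > 0" using m(1) less.prems(1) by (cases m) auto
    have "p dvd q"
      using p m prime_dvd_mult_iff by blast
    then have "q > 1"
      using less.prems(1) m(1) p(1) by (metis One_nat_def Suc_lessI dvd_1_iff_1 mult_eq_0_iff nat_dvd_1_iff_1 neq0_conv not_prime_1)
    then have "m < n" using m(1) m0 by simp
    moreover have "of_nat (r ^ multiplicity r m) dvd x" if r: "prime r" "r dvd m" for r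
    proof -
      have "r ^ multiplicity r m dvd r ^ multiplicity r n"
        using m(1) less.prems(1) by (intro le_imp_power_dvd dvd_imp_multiplicity_le) auto
      then have "of_nat (r ^ multiplicity r m) dvd (of_nat (r ^ multiplicity r n) :: 'p)"
        by (rule of_nat_dvd_of_nat)
      then show ?thesis
        using less.prems(2)[of r] r m(1) dvd_trans by (metis dvd_mult)
    qed
    ultimately have mx: "of_nat m dvd x"
      using less.IH m0 by blast
    have qx: "of_nat q dvd x"
      using less.prems(2)[OF p] by (simp add: q_def)
    have "coprime (int q) (int m)"
      using p(1) m(2) by (simp add: q_def prime_imp_coprime)
    then obtain a b where "a * int q + b * int m = 1"
      using bezout_int[of "int q" "int m"] by auto
    then have "of_int (a * int q + b * int m) * x = x"
      by simp
    then have "x = of_int a * (of_nat q * x) + of_int b * (of_nat m * x)"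
      by (simp add: algebra_simps)
    moreover have "of_nat n dvd of_nat q * x" "of_nat n dvd of_nat m * x"
      using mult_dvd_mono[OF dvd_refl[of "of_nat q"] mx] mult_dvd_mono[OF dvd_refl[of "of_nat m"] qx]
      by (simp_all add: m(1) mult.commute)
    ultimately show ?thesis
      by (metis dvd_add dvd_mult)
  qed simp
qed

definition (in frobenius_lifts) dwork :: "'a tposet \<Rightarrow> ('a \<Rightarrow> 'p) \<Rightarrow> bool" where
  "dwork S x \<longleftrightarrow> (\<forall>p u s. prime p \<longrightarrow> (u, s) \<in> rel S \<longrightarrow> nrm S s = p * nrm S u \<longrightarrow>
     of_nat (p ^ multiplicity p (nrm S s)) dvd x s - \<phi> p (x u))"

context frobenius_lifts
begin

context
  fixes S :: "'a tposet"
  assumes S: "truncation_poset S"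
begin

interpretation tposet S by standard (rule S)

text \<open>The points \<open>t\<close> below \<open>s\<close> split in two. If \<open>t\<close> is
  not below \<open>u\<close>, then \<open>|s| / |t|\<close> is prime to \<open>p\<close> and
  \<open>|t|\<close> carries the full power of \<open>p\<close>. If it is, \<open>|t|\<close> and
  the estimate \<open>dvd_power\<close> share that power. The summand at \<open>s\<close> is left
  out so that both directions of Dwork's lemma can use the estimate, one of them before
  \<open>a s\<close> is known.\<close>

lemma dwork_step:
  assumes p: "prime p" and us: "(u, s) \<in> rel S" and nrm: "nrm S s = p * nrm S u"
  shows "of_nat (p ^ multiplicity p (nrm S s)) dvd
    (\<Sum>t\<in>below S s - {s}. of_nat (nrm S t) * a t ^ (nrm S s div nrm S t)) -
    \<phi> p (\<Sum>t\<in>below S u. of_nat (nrm S t) * a t ^ (nrm S u div nrm S t))"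
proof -
  define v where "v = multiplicity p (nrm S s)"
  define R where "R = below S s - {s} - below S u"
  have s: "s \<in> pts S" and u: "u \<in> pts S" using rel_pts[OF us] by auto
  have p1: "p > 1" using p prime_gt_1_nat by blast
  have "\<not> nrm S s dvd nrm S u"
    using nrm p1 nrm_pos[OF u] by (auto dest: dvd_imp_le)
  then have dec: "below S s - {s} = below S u \<union> R" "below S u \<inter> R = {}"
    using below_eq[OF us] by (auto simp: R_def)
  have fin: "finite (below S u)" "finite R"
    using finite_below s u by (auto simp: R_def)
  have eq: "(\<Sum>t\<in>below S s - {s}. of_nat (nrm S t) * a t ^ (nrm S s div nrm S t)) -
      \<phi> p (\<Sum>t\<in>below S u. of_nat (nrm S t) * a t ^ (nrm S u div nrm S t)) =
    (\<Sum>t\<in>R. of_nat (nrm S t) * a t ^ (nrm S s div nrm S t)) -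
    (\<Sum>t\<in>below S u. of_nat (nrm S t) *
        (\<phi> p (a t) ^ (nrm S u div nrm S t) - a t ^ (nrm S s div nrm S t)))"
    unfolding dec(1) sum.union_disjoint[OF fin dec(2)]
    by (simp add: sum mult of_nat power right_diff_distrib sum_subtractf)
  have "of_nat (p ^ v) dvd of_nat (nrm S t) * a t ^ (nrm S s div nrm S t)" if t: "t \<in> R" for t
  proof -
    have ts: "(t, s) \<in> rel S" and tu: "\<not> nrm S t dvd nrm S u"
      using t below_eq[OF us] by (auto simp: R_def mem_below_iff)
    obtain c where c: "nrm S s = nrm S t * c"
      using rel_dvd[OF ts] by (auto elim: dvdE)
    \<comment> \<open>Otherwise \<open>|u| = |t| * (c / p)\<close>, and \<open>t\<close> would lie
      below \<open>u\<close>.\<close>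
    have "\<not> p dvd c"
      using tu c nrm p1 by (auto elim!: dvdE)
    moreover have "c \<noteq> 0" "nrm S t \<noteq> 0"
      using c nrm_pos[OF s] by auto
    ultimately have "v = multiplicity p (nrm S t)"
      using c p by (simp add: v_def prime_elem_multiplicity_mult_distrib
          not_dvd_imp_multiplicity_0)
    then have "p ^ v dvd nrm S t"
      by (simp add: multiplicity_dvd)
    then show ?thesis
      by (intro dvd_mult2 of_nat_dvd_of_nat)
  qed
  moreover have "of_nat (p ^ v) dvd of_nat (nrm S t) *
      (\<phi> p (a t) ^ (nrm S u div nrm S t) - a t ^ (nrm S s div nrm S t))"
    if t: "t \<in> below S u" for t
  proof -
    obtain m where m: "nrm S u = nrm S t * m"
      using rel_dvd[of t u] t by (auto simp: mem_below_iff elim!: dvdE)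
    then have m0: "m > 0" "nrm S t > 0"
      using nrm_pos[OF u] by auto
    have "v = multiplicity p (nrm S t) + Suc (multiplicity p m)"
      unfolding v_def nrm m using p p1 m0
      by (simp add: prime_elem_multiplicity_mult_distrib)
    then have "of_nat (p ^ v) = of_nat (p ^ multiplicity p (nrm S t)) *
        (of_nat (p ^ Suc (multiplicity p m)) :: 'p)"
      by (simp only: power_add of_nat_mult)
    moreover have "(of_nat (p ^ multiplicity p (nrm S t)) :: 'p) dvd of_nat (nrm S t)"
      by (intro of_nat_dvd_of_nat multiplicity_dvd)
    ultimately have "of_nat (p ^ v) dvd of_nat (nrm S t) * (\<phi> p (a t) ^ m - a t ^ (p * m))"
      using dvd_power[OF p m0(1)] by (metis mult_dvd_mono)
    then show ?thesis
      using m nrm m0 by (simp add: mult.left_commute)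
  qed
  ultimately show ?thesis
    unfolding eq v_def[symmetric] by (intro dvd_diff dvd_sum) auto
qed

lemma below_split:
  fixes g :: "'a \<Rightarrow> 'p"
  assumes "s \<in> pts S"
  shows "sum g (below S s) = g s + sum g (below S s - {s})"
  using assms rel_refl by (intro sum.remove) (auto simp: finite_below mem_below_iff)

lemma dwork_ghost: "dwork S (ghost S ring_of_type_algebra a)"
  unfolding dwork_def
proof (intro allI impI)
  fix p u s assume asm: "prime p" "(u, s) \<in> rel S" "nrm S s = p * nrm S u"
  then have s: "s \<in> pts S" "u \<in> pts S" using rel_pts by auto
  have "(of_nat (p ^ multiplicity p (nrm S s)) :: 'p) dvd of_nat (nrm S s)"
    by (intro of_nat_dvd_of_nat multiplicity_dvd)
  then have "(of_nat (p ^ multiplicity p (nrm S s))) dvd of_nat (nrm S s) * a s +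
    ((\<Sum>t\<in>below S s - {s}. of_nat (nrm S t) * a t ^ (nrm S s div nrm S t)) -
    \<phi> p (\<Sum>t\<in>below S u. of_nat (nrm S t) * a t ^ (nrm S u div nrm S t)))"
    by (intro dvd_add dvd_mult2 dwork_step[OF asm])
  then show "of_nat (p ^ multiplicity p (nrm S s)) dvd
      ghost S ring_of_type_algebra a s - \<phi> p (ghost S ring_of_type_algebra a u)"
    using s nrm_pos[OF s(1)] by (simp add: ghost_type_algebra below_split[OF s(1)] add_diff_eq)
qed

text \<open>The congruences say that, once the smaller coordinates are known, what is left of
  \<open>x s\<close> is divisible by \<open>|s|\<close>; a quotient is the next coordinate.\<close>

lemma dwork_imp_ghost:
  assumes x: "x \<in> extensional (pts S)" and dw: "dwork S x"
  shows "\<exists>a\<in>witt S ring_of_type_algebra. ghost S ring_of_type_algebra a = x"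
proof -
  let ?rest = "\<lambda>a s. \<Sum>t\<in>below S s - {s}. of_nat (nrm S t) * a t ^ (nrm S s div nrm S t)"
  \<comment> \<open>The quotient may be ambiguous in a ring with torsion, so it is chosen, and later
    choices depend on earlier ones through well-founded recursion. The value
    \<open>undefined\<close> off the poset makes the result extensional.\<close>
  define H where "H = (\<lambda>a s. if s \<in> pts S
    then SOME c. of_nat (nrm S s) * c = x s - ?rest a s else undefined)"
  define a where "a = wfrec (measure (nrm S)) H"
  have a: "a s = H a s" for s
  proof -
    have "a s = H (cut a (measure (nrm S)) s) s"
      by (rule def_wfrec[of a, OF eq_reflection[OF a_def]]) simp
    \<comment> \<open>The recursion reads \<open>a\<close> only at points strictly below
      \<open>s\<close>, whose norms are smaller, so \<open>cut\<close> changes nothing.\<close>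
    also have "?rest (cut a (measure (nrm S)) s) s = ?rest a s" if "s \<in> pts S"
      using that nrm_less by (intro sum.cong) (auto simp: cut_apply mem_below_iff)
    then have "H (cut a (measure (nrm S)) s) s = H a s"
      by (simp add: H_def)
    finally show ?thesis .
  qed
  have ghost_a: "ghost S ring_of_type_algebra a s = x s" if "s \<in> pts S" for s
    using that
  proof (induction "nrm S s" arbitrary: s rule: less_induct)
    case (less s)
    have "of_nat (nrm S s) dvd x s - ?rest a s"
    proof (rule of_nat_dvd_if_prime_powers_dvd)
      fix p assume p: "prime p" "p dvd nrm S s"
      then obtain u where u: "(u, s) \<in> rel S" "nrm S u = nrm S s div p"
        using ex_below[of s "nrm S s div p"] less.prems by (auto simp: div_dvd_iff_mult)
      have us: "nrm S s = p * nrm S u" using u p by simp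
      have "nrm S u < nrm S s"
        using us prime_gt_1_nat[OF p(1)] nrm_pos[of u] rel_pts[OF u(1)] by simp
      then have "x u = ghost S ring_of_type_algebra a u"
        using less.hyps rel_pts[OF u(1)] by simp
      then have "x u = (\<Sum>t\<in>below S u. of_nat (nrm S t) * a t ^ (nrm S u div nrm S t))"
        using rel_pts[OF u(1)] by (simp add: ghost_type_algebra)
      then have "of_nat (p ^ multiplicity p (nrm S s)) dvd ?rest a s - \<phi> p (x u)"
        using dwork_step[OF p(1) u(1) us] by simp
      moreover have "of_nat (p ^ multiplicity p (nrm S s)) dvd x s - \<phi> p (x u)"
        using dw p(1) u(1) us unfolding dwork_def by blast
      \<comment> \<open>One congruence comes from the hypothesis on \<open>x\<close>, the other from
        the coordinates found so far; their difference eliminates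
        \<open>\<phi> p (x u)\<close>.\<close>
      ultimately have "of_nat (p ^ multiplicity p (nrm S s)) dvd
          (x s - \<phi> p (x u)) - (?rest a s - \<phi> p (x u))"
        by - (rule dvd_diff)
      then show "of_nat (p ^ multiplicity p (nrm S s)) dvd x s - ?rest a s"
        by simp
    qed (rule nrm_pos[OF less.prems])
    then have "\<exists>c. of_nat (nrm S s) * c = x s - ?rest a s"
      unfolding dvd_def by (auto simp: eq_commute)
    then have "of_nat (nrm S s) * a s = x s - ?rest a s"
      using less.prems by (subst a) (simp add: H_def, rule someI_ex)
    then show ?case
      using less.prems nrm_pos[OF less.prems] by (simp add: ghost_type_algebra below_split)
  qed
  have "a \<in> witt S ring_of_type_algebra"
    by (auto simp: witt_def PiE_iff extensional_def a[of _] H_def)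
  moreover have "ghost S ring_of_type_algebra a = x"
    using ghost_a x by (intro extensionalityI[of _ "pts S"]) (auto simp: ghost_def)
  ultimately show ?thesis by blast
qed

end

end

section \<open>Natural maps of Witt vectors\<close>

lemma ring_hom_nat_pow:
  assumes "cring k" "cring k'" "h \<in> ring_hom k k'" "x \<in> carrier k"
  shows "h (x [^]\<^bsub>k\<^esub> (n::nat)) = h x [^]\<^bsub>k'\<^esub> n"
proof -
  interpret ring_hom_cring k k' h
    using assms by (auto intro!: ring_hom_cring.intro ring_hom_cring_axioms.intro)
  show ?thesis using assms(4) by (induction n) simp_all
qed

lemma ring_hom_add_pow:
  assumes "cring k" "cring k'" "h \<in> ring_hom k k'" "x \<in> carrier k"
  shows "h ([(n::nat)] \<cdot>\<^bsub>k\<^esub> x) = [n] \<cdot>\<^bsub>k'\<^esub> h x"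
proof -
  interpret ring_hom_cring k k' h
    using assms by (auto intro!: ring_hom_cring.intro ring_hom_cring_axioms.intro)
  show ?thesis using assms(4) by (induction n) simp_all
qed

lemma ghost_closed:
  assumes "cring k" "a \<in> witt S k"
  shows "ghost S k a \<in> witt S k"
proof -
  interpret cring k by fact
  show ?thesis
    using assms(2) unfolding witt_def ghost_def PiE_iff by (auto intro!: finsum_closed)
qed

lemma witt_compose:
  "h \<in> ring_hom k k' \<Longrightarrow> a \<in> witt S k \<Longrightarrow> compose (pts S) h a \<in> witt S k'"
  by (auto simp: witt_def compose_def PiE_iff ring_hom_def)

lemma ghost_natural:
  assumes k: "cring k" "cring k'" and h: "h \<in> ring_hom k k'" and a: "a \<in> witt S k"
  shows "ghost S k' (compose (pts S) h a) = compose (pts S) h (ghost S k a)"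
proof -
  interpret ring_hom_cring k k' h
    using assms by (auto intro!: ring_hom_cring.intro ring_hom_cring_axioms.intro)
  have a': "a t \<in> carrier k" if "t \<in> pts S" for t
    using a that by (auto simp: witt_def)
  let ?g = "\<lambda>s t. [nrm S t] \<cdot>\<^bsub>k\<^esub> (a t [^]\<^bsub>k\<^esub> (nrm S s div nrm S t))"
  have "h (finsum k (?g s) (below S s)) =
      finsum k' (\<lambda>t. [nrm S t] \<cdot>\<^bsub>k'\<^esub> (h (a t) [^]\<^bsub>k'\<^esub> (nrm S s div nrm S t))) (below S s)" for s
  proof (subst hom_finsum)
    show "?g s \<in> below S s \<rightarrow> carrier k"
      using a' by (auto simp: below_def)
    show "finsum k' (h \<circ> ?g s) (below S s) =
      finsum k' (\<lambda>t. [nrm S t] \<cdot>\<^bsub>k'\<^esub> (h (a t) [^]\<^bsub>k'\<^esub> (nrm S s div nrm S t))) (below S s)"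
      using a' by (intro S.finsum_cong')
        (auto simp: below_def ring_hom_add_pow[OF k h] ring_hom_nat_pow[OF k h])
  qed
  moreover have "ghost S k' (compose (pts S) h a) s = (if s \<in> pts S then
      finsum k' (\<lambda>t. [nrm S t] \<cdot>\<^bsub>k'\<^esub> (h (a t) [^]\<^bsub>k'\<^esub> (nrm S s div nrm S t))) (below S s)
      else undefined)" for s
    using a' unfolding ghost_def below_def
    by (auto simp: compose_def intro!: S.finsum_cong')
  ultimately show ?thesis
    by (simp add: fun_eq_iff compose_def ghost_def below_def)
qed

text \<open>The description under \<open>THE\<close> in \<open>star_map\<close> and
  \<open>oplus_map\<close>, with the ghost map as a parameter, so that composites along diagrams
  obey the same uniqueness statement as single arrows.\<close>

definition lifts :: "'a tposet \<Rightarrow> 'b tposet \<Rightarrow> ('r ring \<Rightarrow> ('a \<Rightarrow> 'r) \<Rightarrow> ('b \<Rightarrow> 'r)) \<Rightarrow>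
    ('r ring \<Rightarrow> ('a \<Rightarrow> 'r) \<Rightarrow> ('b \<Rightarrow> 'r)) \<Rightarrow> bool" where
  "lifts S T G F \<longleftrightarrow> natural_witt_map S T F \<and>
     (\<forall>k. cring k \<longrightarrow> (\<forall>a \<in> witt S k. ghost T k (F k a) = G k (ghost S k a)))"

text \<open>The coordinates \<open>U\<close> of the image of the generic Witt vector \<open>Z\<close>, whose entries are
  variables indexed by the points of \<open>S\<close>, are the universal polynomials that define the lift.\<close>

lemma ex_lift:
  fixes S :: "'a tposet" and T :: "'b tposet"
    and G :: "'r ring \<Rightarrow> ('a \<Rightarrow> 'r) \<Rightarrow> ('b \<Rightarrow> 'r)"
    and G\<^sub>0 :: "('a \<Rightarrow> 'a zpoly) \<Rightarrow> ('b \<Rightarrow> 'a zpoly)"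
  assumes S: "truncation_poset S" and T: "truncation_poset T"
    and ext: "\<And>x. G\<^sub>0 x \<in> extensional (pts T)"
    and dwork: "\<And>x. zfrob.dwork S x \<Longrightarrow> zfrob.dwork T (G\<^sub>0 x)"
    and natural: "\<And>k h x. cring k \<Longrightarrow> h \<in> ring_hom zring k \<Longrightarrow>
      G k (compose (pts S) h x) = compose (pts T) h (G\<^sub>0 x)"
  shows "\<exists>F. lifts S T G F"
proof -
  define Z where "Z = (\<lambda>s\<in>pts S. zvar s)"
  have Z: "Z \<in> witt S zring"
    by (simp add: Z_def witt_def)
  obtain U where U: "U \<in> witt T zring" "ghost T zring U = G\<^sub>0 (ghost S zring Z)"
    using zfrob.dwork_imp_ghost[OF T ext dwork[OF zfrob.dwork_ghost[OF S]]] by blast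
  \<comment> \<open>Evaluation wants a value in the carrier for every variable of the type. Off the
    poset it is the unit, which ring homomorphisms preserve; the naturality of \<open>F\<close> uses
    this.\<close>
  define ev where
    "ev = (\<lambda>(k :: 'r ring) a. zpoly_eval k (\<lambda>s. if s \<in> pts S then a s else \<one>\<^bsub>k\<^esub>))"
  have ev: "ev k a \<in> ring_hom zring k" "\<And>s. ev k a (zvar s) = (if s \<in> pts S then a s else \<one>\<^bsub>k\<^esub>)"
    if "cring k" "a \<in> witt S k" for k a
  proof -
    interpret cring k by fact
    have "(if s \<in> pts S then a s else \<one>\<^bsub>k\<^esub>) \<in> carrier k" for s
      using that(2) by (auto simp: witt_def)
    note a = this
    show "ev k a \<in> ring_hom zring k"
      unfolding ev_def by (rule zpoly_eval_hom[OF that(1) a])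
    show "ev k a (zvar s) = (if s \<in> pts S then a s else \<one>\<^bsub>k\<^esub>)" for s
      unfolding ev_def by (rule zpoly_eval_zvar[OF that(1) a])
  qed
  have ev_Z: "compose (pts S) (ev k a) Z = a" if "cring k" "a \<in> witt S k" for k a
    using ev(2)[OF that] that(2)
    by (intro extensionalityI[of _ "pts S"]) (auto simp: compose_def Z_def witt_def PiE_iff)
  define F where "F = (\<lambda>k\<in>{k. cring k}. \<lambda>a\<in>witt S k. compose (pts T) (ev k a) U)"
  have "lifts S T G F"
    unfolding lifts_def natural_witt_map_def
  proof (intro conjI allI impI ballI)
    show "F \<in> (\<Pi>\<^sub>E k\<in>{k. cring k}. witt S k \<rightarrow>\<^sub>E witt T k)"
      unfolding F_def using U(1) ev(1) by (auto intro!: witt_compose)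
  next
    fix k k' :: "'r ring" and h a
    assume "cring k \<and> cring k' \<and> h \<in> ring_hom k k'" and a: "a \<in> witt S k"
    then have k: "cring k" "cring k'" and h: "h \<in> ring_hom k k'" by auto
    have ha: "compose (pts S) h a \<in> witt S k'" by (rule witt_compose[OF h a])
    have "ev k' (compose (pts S) h a) f = (h \<circ> ev k a) f" for f
    proof (rule zpoly_hom_eqI[OF k(2) ev(1)[OF k(2) ha] ring_hom_trans[OF ev(1)[OF k(1) a] h]])
      show "ev k' (compose (pts S) h a) (zvar s) = (h \<circ> ev k a) (zvar s)" for s
        using ev(2)[OF k(2) ha] ev(2)[OF k(1) a] ring_hom_one[OF h] by (simp add: compose_def)
    qed
    then show "F k' (compose (pts S) h a) = compose (pts T) h (F k a)"
      using k a ha by (simp add: F_def compose_def fun_eq_iff)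
  next
    fix k :: "'r ring" and a assume k: "cring k" and a: "a \<in> witt S k"
    have "ghost T k (F k a) = compose (pts T) (ev k a) (ghost T zring U)"
      using ghost_natural[OF zring_cring k ev(1)[OF k a] U(1)] k a by (simp add: F_def)
    also have "\<dots> = G k (compose (pts S) (ev k a) (ghost S zring Z))"
      unfolding U(2) by (rule natural[OF k ev(1)[OF k a], symmetric])
    also have "\<dots> = G k (ghost S k a)"
      using ghost_natural[OF zring_cring k ev(1)[OF k a] Z] ev_Z[OF k a] by simp
    finally show "ghost T k (F k a) = G k (ghost S k a)" .
  qed
  then show ?thesis by blast
qed

section \<open>Torsion-free covers and uniqueness of lifts\<close>

definition torsion_free :: "'r ring \<Rightarrow> bool" where
  "torsion_free k \<longleftrightarrow> (\<forall>n>0. \<forall>x\<in>carrier k. [(n::nat)] \<cdot>\<^bsub>k\<^esub> x = \<zero>\<^bsub>k\<^esub> \<longrightarrow> x = \<zero>\<^bsub>k\<^esub>)"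

text \<open>Induction on the norm: when all smaller coordinates agree, equal ghost components leave
  \<open>|s| * (a s - b s) = 0\<close>.\<close>

lemma ghost_inj:
  assumes S: "truncation_poset S" and k: "cring k" "torsion_free k"
    and a: "a \<in> witt S k" and b: "b \<in> witt S k" and eq: "ghost S k a = ghost S k b"
  shows "a = b"
proof -
  interpret tposet S by standard (rule S)
  interpret cring k by (rule k)
  have ac: "a s \<in> carrier k" and bc: "b s \<in> carrier k" if "s \<in> pts S" for s
    using a b that by (auto simp: witt_def)
  have "a s = b s" if "s \<in> pts S" for s
    using that
  proof (induction "nrm S s" arbitrary: s rule: less_induct)
    case (less s)
    let ?g = "\<lambda>a t. [nrm S t] \<cdot>\<^bsub>k\<^esub> (a t [^]\<^bsub>k\<^esub> (nrm S s div nrm S t))"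
    let ?n = "nrm S s"
    have split: "ghost S k c s = [?n] \<cdot>\<^bsub>k\<^esub> c s \<oplus>\<^bsub>k\<^esub> finsum k (?g c) (below S s - {s})"
      if c: "\<And>t. t \<in> pts S \<Longrightarrow> c t \<in> carrier k" for c
    proof -
      have "below S s = insert s (below S s - {s})"
        using rel_refl[OF less.prems] by (auto simp: mem_below_iff)
      then have "ghost S k c s = finsum k (?g c) (insert s (below S s - {s}))"
        using less.prems by (simp add: ghost_def below_def[symmetric])
      also have "\<dots> = ?g c s \<oplus>\<^bsub>k\<^esub> finsum k (?g c) (below S s - {s})"
        using finite_below[OF less.prems] c less.prems
        by (intro finsum_insert) (auto simp: below_def)
      finally show ?thesis
        using nrm_pos[OF less.prems] c[OF less.prems] by simp
    qed
    have rest: "finsum k (?g a) (below S s - {s}) = finsum k (?g b) (below S s - {s})"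
      using less.hyps nrm_less rel_pts bc by (intro finsum_cong') (auto simp: mem_below_iff)
    have closed: "finsum k (?g b) (below S s - {s}) \<in> carrier k"
      using bc by (intro finsum_closed) (auto simp: below_def)
    have c: "a s \<in> carrier k" "b s \<in> carrier k" using ac bc less.prems by auto
    have "[?n] \<cdot>\<^bsub>k\<^esub> a s = [?n] \<cdot>\<^bsub>k\<^esub> b s"
      using split[of a, OF ac] split[of b, OF bc] eq rest closed c by simp
    then have "[?n] \<cdot>\<^bsub>k\<^esub> (a s \<ominus>\<^bsub>k\<^esub> b s) = \<zero>\<^bsub>k\<^esub>"
      using c by (simp add: a_minus_def add.nat_pow_distrib add.nat_pow_inv r_neg)
    then show ?case
      using k(2) nrm_pos[OF less.prems] c unfolding torsion_free_def by (metis minus_closed r_right_minus_eq)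
  qed
  then show ?thesis
    using a b by (intro extensionalityI[of _ "pts S"]) (auto simp: witt_def PiE_iff)
qed

lemma ex_inj_list:
  assumes "infinite (UNIV :: 'r set)"
  shows "\<exists>e :: 'r list \<Rightarrow> 'r. inj e"
proof -
  obtain i :: "nat \<Rightarrow> 'r" where i: "inj i"
    using assms infinite_countable_subset by blast
  obtain j :: "'r \<times> 'r \<Rightarrow> 'r" where j: "inj j"
    using card_of_Times_same_infinite[OF assms, THEN ordIso_imp_ordLeq,
      unfolded card_of_ordLeq[symmetric]] by auto
  \<comment> \<open>The fold ends in the constant \<open>i 0\<close>, so it is shown to separate
    only lists of equal length; the length is therefore stored beside it.\<close>
  define c where "c = (\<lambda>xs :: 'r list. foldr (\<lambda>x y. j (x, y)) xs (i 0))"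
  have "xs = ys" if "length xs = length ys" "c xs = c ys" for xs ys
    using that by (induction xs ys rule: list_induct2) (simp_all add: c_def inj_eq[OF j])
  then have "inj (\<lambda>xs. j (i (length xs), c xs))"
    by (intro injI) (simp add: inj_eq[OF i] inj_eq[OF j])
  then show ?thesis by blast
qed

text \<open>A polynomial is named by a finite list of terms, each a list of variables with an
  integer coefficient. Names embed into \<open>'r\<close> because lists do, and a right inverse of
  the reading map \<open>v\<close> embeds polynomials into names.\<close>

lemma ex_inj_zpoly:
  assumes "infinite (UNIV :: 'r set)"
  shows "\<exists>e :: 'r zpoly \<Rightarrow> 'r. inj e"
proof -
  obtain e :: "'r list \<Rightarrow> 'r" where e: "inj e"
    using ex_inj_list[OF assms] by blast
  obtain i :: "int \<Rightarrow> 'r" where i: "inj i"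
    using assms infinite_countable_subset by (metis inj_compose inj_to_nat)
  define m where "m = (\<lambda>(xs :: 'r list, c). e (i c # xs))"
  have m: "inj m"
    by (intro injI) (auto simp: m_def inj_eq[OF e] inj_eq[OF i])
  define v :: "('r list \<times> int) list \<Rightarrow> 'r zpoly" where
    "v = (\<lambda>ts. \<Sum>(xs, c)\<leftarrow>ts. Poly_Mapping.single (mset xs) c)"
  have v_surj: "\<exists>ts. v ts = f" for f
  proof (induction f rule: frag_induction[OF subset_UNIV])
    case 1
    have "v [] = 0" by (simp add: v_def)
    then show ?case by blast
  next
    case (2 x)
    obtain xs where "mset xs = x" using ex_mset by blast
    then have "v [(xs, 1)] = frag_of x" by (simp add: v_def)
    then show ?case by blast
  next
    case (3 f g)
    then obtain ts us where "v ts = f" "v us = g" by blast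
    moreover have "v (map (\<lambda>(xs, c). (xs, - c)) us) = - v us"
      by (induction us) (auto simp: v_def single_uminus)
    ultimately have "v (ts @ map (\<lambda>(xs, c). (xs, - c)) us) = f - g"
      by (simp add: v_def)
    then show ?case by blast
  qed
  have "inj (e \<circ> map m \<circ> inv_into UNIV v)"
    using e m v_surj by (intro inj_compose) (auto intro!: surj_imp_inj_inv simp: surj_def eq_commute)
  then show ?thesis by blast
qed

text \<open>The variables are the elements of \<open>'r\<close>, those of \<open>k\<close> being
  evaluated at themselves, which makes surjectivity immediate. The ring structure is carried to the
  range of an injection because naturality speaks only of rings of type
  \<open>'r ring\<close>.\<close>

lemma ex_torsion_free_cover:
  fixes k :: "'r ring"
  assumes inf: "infinite (UNIV :: 'r set)" and k: "cring k"
  shows "\<exists>(K :: 'r ring) h. cring K \<and> torsion_free K \<and> h \<in> ring_hom K k \<and> h ` carrier K = carrier k"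
proof -
  interpret cring k by (rule k)
  obtain e :: "'r zpoly \<Rightarrow> 'r" where e: "inj e"
    using ex_inj_zpoly[OF inf] by blast
  define d where "d = inv_into UNIV e"
  have d [simp]: "d (e f) = f" for f
    using e by (simp add: d_def)
  have e_eq [simp]: "e f = e g \<longleftrightarrow> f = g" for f g
    using e by (auto dest: injD)
  define K :: "'r ring" where "K = \<lparr>carrier = range e, monoid.mult = (\<lambda>x y. e (d x * d y)),
    one = e 1, ring.zero = e 0, add = (\<lambda>x y. e (d x + d y))\<rparr>"
  have K [simp]: "carrier K = range e" "x \<otimes>\<^bsub>K\<^esub> y = e (d x * d y)" "\<one>\<^bsub>K\<^esub> = e 1"
    "\<zero>\<^bsub>K\<^esub> = e 0" "x \<oplus>\<^bsub>K\<^esub> y = e (d x + d y)" for x y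
    by (simp_all add: K_def)
  have "abelian_group K"
  proof (rule abelian_groupI)
    fix x assume "x \<in> carrier K"
    then obtain f where "x = e f" by auto
    then show "\<exists>y\<in>carrier K. y \<oplus>\<^bsub>K\<^esub> x = \<zero>\<^bsub>K\<^esub>"
      by (intro bexI[of _ "e (- f)"]) auto
  qed (auto simp: algebra_simps)
  moreover have "comm_monoid K"
    by (rule comm_monoidI) (auto simp: algebra_simps)
  ultimately have cringK: "cring K"
    by (rule cringI) (auto simp: algebra_simps)
  have add_pow: "[(n::nat)] \<cdot>\<^bsub>K\<^esub> e f = e (of_nat n * f)" for n f
    by (induction n) (simp_all add: add_pow_def nat_pow_def algebra_simps)
  have tf: "torsion_free K"
    using zpoly_torsion_free by (auto simp: torsion_free_def add_pow)
  \<comment> \<open>Elements of the type outside \<open>k\<close> are variables too; they go to the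
    unit to stay in the carrier.\<close>
  define ev where "ev = zpoly_eval k (\<lambda>r. if r \<in> carrier k then r else \<one>\<^bsub>k\<^esub>)"
  have ev: "ev \<in> ring_hom zring k"
    unfolding ev_def by (rule zpoly_eval_hom[OF k]) simp
  have ev_zvar: "ev (zvar r) = r" if "r \<in> carrier k" for r
    unfolding ev_def using that by (subst zpoly_eval_zvar[OF k]) auto
  have hom: "ev \<circ> d \<in> ring_hom K k"
    using ev unfolding ring_hom_def by auto
  have "(ev \<circ> d) ` carrier K = carrier k"
  proof (intro equalityI subsetI)
    fix r assume "r \<in> carrier k"
    then have "(ev \<circ> d) (e (zvar r)) = r" by (simp add: ev_zvar)
    then show "r \<in> (ev \<circ> d) ` carrier K" by (metis K(1) imageI rangeI)
  qed (use ring_hom_closed[OF hom] in \<open>simp; blast\<close>)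
  then show ?thesis using cringK tf hom by blast
qed

text \<open>Over a torsion-free cover the ghost map is injective, so \<open>F\<close> and
  \<open>F'\<close> agree there; naturality along the surjection carries this down to
  \<open>k\<close>. Two ghost families are allowed so that different diagrams can be
  compared.\<close>

lemma lifts_unique:
  fixes F F' :: "'r ring \<Rightarrow> ('a \<Rightarrow> 'r) \<Rightarrow> ('b \<Rightarrow> 'r)"
  assumes inf: "infinite (UNIV :: 'r set)" and T: "truncation_poset T"
    and F: "lifts S T G F" and F': "lifts S T G' F'"
    and eq: "\<And>k x. cring k \<Longrightarrow> x \<in> witt S k \<Longrightarrow> G k x = G' k x"
  shows "F = F'"
proof -
  have "F k a = F' k a" if k: "cring k" and a: "a \<in> witt S k" for k a
  proof -
    obtain K :: "'r ring" and h where K: "cring K" "torsion_free K"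
      and h: "h \<in> ring_hom K k" "h ` carrier K = carrier k"
      using ex_torsion_free_cover[OF inf k] by blast
    define b where "b = (\<lambda>s\<in>pts S. inv_into (carrier K) h (a s))"
    have b: "b \<in> witt S K" and hb: "compose (pts S) h b = a"
      using a h(2) by (auto simp: b_def witt_def compose_def fun_eq_iff PiE_iff extensional_def
          inv_into_into f_inv_into_f)
    have "ghost T K (F K b) = ghost T K (F' K b)"
      using F F' K(1) b eq[OF K(1) ghost_closed[OF K(1) b]] by (simp add: lifts_def)
    moreover have "F K b \<in> witt T K" "F' K b \<in> witt T K"
      using F F' K(1) b unfolding lifts_def natural_witt_map_def by (auto simp: PiE_iff)
    ultimately have "F K b = F' K b"
      using ghost_inj[OF T K] by blast
    moreover have "F k a = compose (pts T) h (F K b)" "F' k a = compose (pts T) h (F' K b)"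
      using F F' K(1) k h(1) b unfolding lifts_def natural_witt_map_def hb[symmetric] by blast+
    ultimately show ?thesis by simp
  qed
  moreover have "F \<in> (\<Pi>\<^sub>E k\<in>{k. cring k}. witt S k \<rightarrow>\<^sub>E witt T k)"
    "F' \<in> (\<Pi>\<^sub>E k\<in>{k. cring k}. witt S k \<rightarrow>\<^sub>E witt T k)"
    using F F' by (auto simp: lifts_def natural_witt_map_def)
  ultimately show ?thesis
    by (intro extensionalityI[of F "Collect cring"])
      (auto simp: PiE_iff intro!: extensionalityI[of "F _" "witt S _"])
qed

section \<open>The maps induced by R-maps and T-maps\<close>

lemma rmap_pts: "rmap S T f \<Longrightarrow> s \<in> pts S \<Longrightarrow> f s \<in> pts T"
  by (auto simp: rmap_def)

lemma rmap_rel: "rmap S T f \<Longrightarrow> (s, t) \<in> rel S \<Longrightarrow> (f s, f t) \<in> rel T"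
  by (auto simp: rmap_def)

text \<open>Division of naturals truncates, and divisibility in the target makes the quotient exact.
  It is a separate premise because the target may be a pullback.\<close>

lemma rmap_nrm:
  assumes "rmap S T f" "(u, s) \<in> rel S" "nrm T (f u) dvd nrm T (f s)"
  shows "nrm T (f s) = nrm S s div nrm S u * nrm T (f u)"
proof -
  have "nrm T (f s) div nrm T (f u) = nrm S s div nrm S u"
    using assms(1,2) unfolding rmap_def by blast
  then show ?thesis
    using assms(3) by (metis dvd_div_mult_self)
qed

locale r_map = S: tposet S + T: tposet T
  for S :: "'a tposet" and T :: "'b tposet" +
  fixes f :: "'a \<Rightarrow> 'b"
  assumes rmap: "rmap S T f"
begin

lemma rmap_nrm_mult:
  assumes "(u, s) \<in> rel S" "nrm S s = c * nrm S u"
  shows "nrm T (f s) = c * nrm T (f u)"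
  using rmap_nrm[OF rmap assms(1) T.rel_dvd[OF rmap_rel[OF rmap assms(1)]]] assms S.rel_pts S.nrm_pos[of u]
  by auto

text \<open>Some \<open>u\<close> of norm 1 lies below \<open>s\<close>, so
  \<open>|f s| = |s| * |f u|\<close>.\<close>

lemma rmap_nrm_dvd:
  assumes "s \<in> pts S"
  shows "nrm S s dvd nrm T (f s)"
proof -
  obtain u where "(u, s) \<in> rel S" "nrm S u = 1"
    using S.ex_below[OF assms, of 1] by auto
  then show ?thesis
    using rmap_nrm_mult[of u s "nrm S s"] by simp
qed

end

text \<open>The norm of \<open>s\<close> divides that of \<open>f s\<close>, so the congruence for
  \<open>x\<close> at \<open>f s\<close> is at least as strong as the one wanted at
  \<open>s\<close>.\<close>

lemma (in frobenius_lifts) dwork_ghost_star: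
  assumes "r_map S T f" and x: "dwork T x"
  shows "dwork S (ghost_star S T f x)"
proof -
  interpret r_map S T f by fact
  show ?thesis
    unfolding dwork_def
  proof (intro allI impI)
    fix p u s assume p: "prime p" and us: "(u, s) \<in> rel S" and nrm: "nrm S s = p * nrm S u"
    have s: "s \<in> pts S" "u \<in> pts S" using S.rel_pts[OF us] by auto
    have "of_nat (p ^ multiplicity p (nrm T (f s))) dvd x (f s) - \<phi> p (x (f u))"
      using x p rmap_rel[OF rmap us] rmap_nrm_mult[OF us nrm] unfolding dwork_def by blast
    moreover have "p ^ multiplicity p (nrm S s) dvd p ^ multiplicity p (nrm T (f s))"
      using rmap_nrm_dvd[OF s(1)] T.nrm_pos[OF rmap_pts[OF rmap s(1)]]
      by (intro le_imp_power_dvd dvd_imp_multiplicity_le) auto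
    ultimately show "of_nat (p ^ multiplicity p (nrm S s)) dvd
        ghost_star S T f x s - \<phi> p (ghost_star S T f x u)"
      using s by (simp only: ghost_star_def restrict_apply' dvd_trans[OF of_nat_dvd_of_nat])
  qed
qed

context r_map
begin

lemma ghost_star_natural:
  "ghost_star S T f (compose (pts T) h x) = compose (pts S) h (ghost_star S T f x)"
  using rmap_pts[OF rmap] by (auto simp: ghost_star_def compose_def)

lemma star_map_lifts:
  assumes inf: "infinite (UNIV :: 'r set)"
  shows "lifts T S (\<lambda>k. ghost_star S T f) (star_map S T f :: 'r ring \<Rightarrow> _)"
proof -
  have "\<exists>F :: 'r ring \<Rightarrow> _. lifts T S (\<lambda>k. ghost_star S T f) F"
    by (rule ex_lift[where G\<^sub>0 = "ghost_star S T f"])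
      (use S.truncation_poset T.truncation_poset zfrob.dwork_ghost_star[OF r_map_axioms] ghost_star_natural in \<open>auto simp: ghost_star_def\<close>)
  then have "\<exists>!F :: 'r ring \<Rightarrow> _. lifts T S (\<lambda>k. ghost_star S T f) F"
    using lifts_unique[OF inf S.truncation_poset] by (metis (mono_tags))
  from theI'[OF this] show ?thesis
    unfolding star_map_def lifts_def .
qed

end

section \<open>Fibres of T-maps\<close>

definition fibre :: "'a tposet \<Rightarrow> ('a \<Rightarrow> 'b) \<Rightarrow> 'b \<Rightarrow> 'a set" where
  "fibre S f t = {s \<in> pts S. f s = t}"

locale t_map = S: tposet S + T: tposet T
  for S :: "'a tposet" and T :: "'b tposet" +
  fixes f :: "'a \<Rightarrow> 'b"
  assumes tmap: "tmap S T f"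
begin

sublocale r_map S T f
  by unfold_locales (use tmap in \<open>simp add: tmap_def\<close>)

lemma tmap_finite_fibre: "t \<in> pts T \<Longrightarrow> finite (fibre S f t)"
  using tmap by (simp add: tmap_def fibre_def)

lemma fibre_nrm_dvd: "s \<in> fibre S f t \<Longrightarrow> nrm S s dvd nrm T t"
  using rmap_nrm_dvd by (auto simp: fibre_def)

text \<open>For \<open>s\<close> over \<open>u\<close> the T-condition provides \<open>g s\<close>
  over \<open>t\<close>, and preservation of quotients forces its norm. Uniqueness below makes
  \<open>g\<close> injective. A point over \<open>t\<close> with norm divisible by \<open>p\<close>
  has a quotient by \<open>p\<close> lying over \<open>u\<close>, and uniqueness above shows that
  \<open>g\<close> takes this quotient back to the point.\<close>

lemma fibre_bij_betw:
  assumes ut: "(u, t) \<in> rel T" and nrm: "nrm T t = p * nrm T u"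
  shows "\<exists>g. bij_betw g (fibre S f u) {s \<in> fibre S f t. p dvd nrm S s} \<and>
    (\<forall>s\<in>fibre S f u. (s, g s) \<in> rel S \<and> nrm S (g s) = p * nrm S s)"
proof -
  have t: "t \<in> pts T" "u \<in> pts T" using T.rel_pts[OF ut] by auto
  have p: "p > 0" using nrm T.nrm_pos[OF t(1)] by (cases p) auto
  have "\<exists>s'. (s, s') \<in> rel S \<and> s' \<in> fibre S f t" if "s \<in> fibre S f u" for s
    using that tmap ut t unfolding tmap_def fibre_def by blast
  then obtain g where g: "\<And>s. s \<in> fibre S f u \<Longrightarrow> (s, g s) \<in> rel S \<and> g s \<in> fibre S f t"
    by metis
  have nrm_g: "nrm S (g s) = p * nrm S s" if s: "s \<in> fibre S f u" for s
  proof -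
    obtain c where c: "nrm S (g s) = c * nrm S s"
      using S.rel_dvd g[OF s] by (metis dvd_def mult.commute)
    have "nrm T t = c * nrm T u"
      using rmap_nrm_mult[of s "g s"] g[OF s] c s by (auto simp: fibre_def)
    then show ?thesis using c nrm T.nrm_pos[OF t(2)] by simp
  qed
  have "inj_on g (fibre S f u)"
  proof (rule inj_onI)
    fix s s' assume s: "s \<in> fibre S f u" "s' \<in> fibre S f u" "g s = g s'"
    then have "nrm S s = nrm S s'"
      using nrm_g[OF s(1)] nrm_g[OF s(2)] p by simp
    then show "s = s'"
      using S.below_unique g s by metis
  qed
  moreover have "g ` fibre S f u = {s \<in> fibre S f t. p dvd nrm S s}"
  proof (intro equalityI subsetI)
    fix s assume s: "s \<in> {s \<in> fibre S f t. p dvd nrm S s}"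
    then have "s \<in> pts S" "f s = t" "p dvd nrm S s" by (auto simp: fibre_def)
    then obtain s' where s': "(s', s) \<in> rel S" "nrm S s' = nrm S s div p"
      using S.ex_below[of s "nrm S s div p"] by (metis dvd_div_mult_self dvd_triv_left)
    have nrm_s: "nrm S s = p * nrm S s'"
      using s'(2) \<open>p dvd nrm S s\<close> by simp
    have "nrm T t = p * nrm T (f s')"
      using rmap_nrm_mult[OF s'(1) nrm_s] \<open>f s = t\<close> by simp
    moreover have "(f s', t) \<in> rel T"
      using rmap_rel[OF rmap s'(1)] \<open>f s = t\<close> by simp
    ultimately have "f s' = u"
      using T.below_unique[OF _ ut] nrm p by simp
    then have "s' \<in> fibre S f u"
      using S.rel_pts[OF s'(1)] by (simp add: fibre_def)
    moreover have "g s' = s"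
      using S.above_unique[of s' "g s'" s] g nrm_g calculation s'(1) nrm_s by simp
    ultimately show "s \<in> g ` fibre S f u" by blast
  qed (use g nrm_g in auto)
  ultimately show ?thesis
    using g nrm_g unfolding bij_betw_def by blast
qed

lemma ghost_oplus_type_algebra:
  fixes x :: "'a \<Rightarrow> 'p :: comm_ring_1"
  shows "ghost_oplus S T f ring_of_type_algebra x =
    (\<lambda>t\<in>pts T. \<Sum>s\<in>fibre S f t. of_nat (nrm T t div nrm S s) * x s)"
  by (simp add: ghost_oplus_def fibre_def)

end

text \<open>Points over \<open>t\<close> with norm prime to \<open>p\<close> drop out through their
  coefficient \<open>|t| / |s|\<close>. The others are matched by \<open>fibre_bij_betw\<close> with
  the points over \<open>u\<close>, with equal coefficients, and the congruence for \<open>x\<close>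
  applies to each pair.\<close>

lemma (in frobenius_lifts) dwork_ghost_oplus:
  assumes "t_map S T f" and x: "dwork S x"
  shows "dwork T (ghost_oplus S T f ring_of_type_algebra x)"
proof -
  interpret t_map S T f by fact
  show ?thesis
    unfolding dwork_def
  proof (intro allI impI)
    fix p u t assume p: "prime p" and ut: "(u, t) \<in> rel T" and nrm: "nrm T t = p * nrm T u"
    define v where "v = multiplicity p (nrm T t)"
    have t: "t \<in> pts T" "u \<in> pts T" using T.rel_pts[OF ut] by auto
    have p0: "p > 0" using p prime_gt_0_nat by blast
    obtain g where g: "bij_betw g (fibre S f u) {s \<in> fibre S f t. p dvd nrm S s}"
      and g_rel: "\<And>s. s \<in> fibre S f u \<Longrightarrow> (s, g s) \<in> rel S"
      and g_nrm: "\<And>s. s \<in> fibre S f u \<Longrightarrow> nrm S (g s) = p * nrm S s"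
      using fibre_bij_betw[OF ut nrm] by blast
    \<comment> \<open>The power of \<open>p\<close> in \<open>|t|\<close> is the product of those in
      \<open>|t| / |s|\<close> and \<open>|s|\<close>. With \<open>p\<close> prime to
      \<open>|s|\<close> the condition on \<open>y\<close> is void; otherwise \<open>y\<close> will
      be a Dwork difference.\<close>
    have v: "of_nat (p ^ v) dvd of_nat (nrm T t div nrm S s) * y"
      if s: "s \<in> fibre S f t" and y: "of_nat (p ^ multiplicity p (nrm S s)) dvd (y :: 'p)" for s y
    proof -
      obtain c where c: "nrm T t = nrm S s * c"
        using fibre_nrm_dvd[OF s] by (auto elim: dvdE)
      then have c0: "c > 0" "nrm S s > 0" using T.nrm_pos[OF t(1)] by auto
      have "v = multiplicity p c + multiplicity p (nrm S s)"
        unfolding v_def c using p c0 by (simp add: prime_elem_multiplicity_mult_distrib)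
      then have "of_nat (p ^ v) = of_nat (p ^ multiplicity p c) *
          (of_nat (p ^ multiplicity p (nrm S s)) :: 'p)"
        by (simp add: power_add)
      moreover have "(of_nat (p ^ multiplicity p c) :: 'p) dvd of_nat c"
        by (intro of_nat_dvd_of_nat multiplicity_dvd)
      ultimately show ?thesis
        using y c c0 by (simp add: mult_dvd_mono)
    qed
    have "(\<Sum>s\<in>fibre S f t. of_nat (nrm T t div nrm S s) * x s) =
        (\<Sum>s\<in>{s \<in> fibre S f t. \<not> p dvd nrm S s}. of_nat (nrm T t div nrm S s) * x s) +
        (\<Sum>s\<in>{s \<in> fibre S f t. p dvd nrm S s}. of_nat (nrm T t div nrm S s) * x s)"
      using tmap_finite_fibre[OF t(1)]
      by (subst sum.union_disjoint[symmetric]) (auto intro!: sum.cong)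
    also have "(\<Sum>s\<in>{s \<in> fibre S f t. p dvd nrm S s}. of_nat (nrm T t div nrm S s) * x s) =
        (\<Sum>s\<in>fibre S f u. of_nat (nrm T t div nrm S (g s)) * x (g s))"
      by (rule sum.reindex_bij_betw[OF g, symmetric])
    finally have "(\<Sum>s\<in>fibre S f t. of_nat (nrm T t div nrm S s) * x s) -
        \<phi> p (\<Sum>s\<in>fibre S f u. of_nat (nrm T u div nrm S s) * x s) =
        (\<Sum>s\<in>{s \<in> fibre S f t. \<not> p dvd nrm S s}. of_nat (nrm T t div nrm S s) * x s) +
        (\<Sum>s\<in>fibre S f u. of_nat (nrm T t div nrm S (g s)) * (x (g s) - \<phi> p (x s)))"
      using p0 g_nrm by (simp add: sum mult of_nat nrm right_diff_distrib sum_subtractf)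
    moreover have "of_nat (p ^ v) dvd
        (\<Sum>s\<in>{s \<in> fibre S f t. \<not> p dvd nrm S s}. of_nat (nrm T t div nrm S s) * x s)"
      by (intro dvd_sum v) (auto simp: not_dvd_imp_multiplicity_0)
    moreover have "of_nat (p ^ v) dvd
        (\<Sum>s\<in>fibre S f u. of_nat (nrm T t div nrm S (g s)) * (x (g s) - \<phi> p (x s)))"
    proof (intro dvd_sum v)
      fix s assume s: "s \<in> fibre S f u"
      show "g s \<in> fibre S f t"
        using g s by (auto simp: bij_betw_def)
      show "of_nat (p ^ multiplicity p (nrm S (g s))) dvd x (g s) - \<phi> p (x s)"
        using x p g_rel[OF s] g_nrm[OF s] unfolding dwork_def by blast
    qed
    ultimately show "of_nat (p ^ multiplicity p (nrm T t)) dvd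
        ghost_oplus S T f ring_of_type_algebra x t -
        \<phi> p (ghost_oplus S T f ring_of_type_algebra x u)"
      using t by (simp add: ghost_oplus_type_algebra v_def dvd_add)
  qed
qed

context t_map
begin

lemma ghost_oplus_natural:
  assumes k: "cring k" "cring k'" and h: "h \<in> ring_hom k k'"
    and x: "\<And>s. s \<in> pts S \<Longrightarrow> x s \<in> carrier k"
  shows "ghost_oplus S T f k' (compose (pts S) h x) = compose (pts T) h (ghost_oplus S T f k x)"
proof -
  interpret ring_hom_cring k k' h
    using assms by (auto intro!: ring_hom_cring.intro ring_hom_cring_axioms.intro)
  let ?g = "\<lambda>t s. [(nrm T t div nrm S s)] \<cdot>\<^bsub>k\<^esub> x s"
  have "h (finsum k (?g t) (fibre S f t)) =
      finsum k' (\<lambda>s. [(nrm T t div nrm S s)] \<cdot>\<^bsub>k'\<^esub> compose (pts S) h x s) (fibre S f t)" for t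
  proof (subst hom_finsum)
    show "?g t \<in> fibre S f t \<rightarrow> carrier k"
      using x by (auto simp: fibre_def)
    show "finsum k' (h \<circ> ?g t) (fibre S f t) =
        finsum k' (\<lambda>s. [(nrm T t div nrm S s)] \<cdot>\<^bsub>k'\<^esub> compose (pts S) h x s) (fibre S f t)"
      using x by (intro S.finsum_cong') (auto simp: fibre_def compose_def ring_hom_add_pow[OF k h])
  qed
  then show ?thesis
    by (simp add: fun_eq_iff compose_def ghost_oplus_def fibre_def)
qed

lemma oplus_map_lifts:
  assumes inf: "infinite (UNIV :: 'r set)"
  shows "lifts S T (ghost_oplus S T f) (oplus_map S T f :: 'r ring \<Rightarrow> _)"
proof -
  have "\<exists>F :: 'r ring \<Rightarrow> _. lifts S T (ghost_oplus S T f) F"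
  proof (rule ex_lift[where G\<^sub>0 = "ghost_oplus S T f zring"])
    show "ghost_oplus S T f k (compose (pts S) h x) = compose (pts T) h (ghost_oplus S T f zring x)"
      if "cring k" "h \<in> ring_hom zring k" for k :: "'r ring" and h x
      by (rule ghost_oplus_natural[OF zring_cring that]) simp
  qed (use S.truncation_poset T.truncation_poset zfrob.dwork_ghost_oplus[OF t_map_axioms] in \<open>auto simp: ghost_oplus_def\<close>)
  then have "\<exists>!F :: 'r ring \<Rightarrow> _. lifts S T (ghost_oplus S T f) F"
    using lifts_unique[OF inf T.truncation_poset] by (metis (mono_tags))
  from theI'[OF this] show ?thesis
    unfolding oplus_map_def lifts_def .
qed

end

section \<open>Identities between ghost maps\<close>

lemma tp_iso_obtain_inverse:
  assumes "tp_iso S T p"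
  obtains q where "rmap T S q" "\<And>s. s \<in> pts S \<Longrightarrow> q (p s) = s" "\<And>t. t \<in> pts T \<Longrightarrow> p (q t) = t"
proof -
  obtain q where q: "rmap T S q" "compose (pts S) q p = tp_id S" "compose (pts T) p q = tp_id T"
    using assms by (auto simp: tp_iso_def)
  show ?thesis
    using that[OF q(1)] fun_cong[OF q(2)] fun_cong[OF q(3)]
    by (simp add: compose_def tp_id_def) (metis restrict_apply')
qed

lemma tp_iso_rmap: "tp_iso S T p \<Longrightarrow> rmap S T p"
  by (simp add: tp_iso_def)

lemma tp_iso_bij_betw:
  assumes "tp_iso S T p"
  shows "bij_betw p (pts S) (pts T)"
proof -
  obtain q where q: "rmap T S q" "\<And>s. s \<in> pts S \<Longrightarrow> q (p s) = s" "\<And>t. t \<in> pts T \<Longrightarrow> p (q t) = t"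
    using tp_iso_obtain_inverse[OF assms] by blast
  show ?thesis
    using q rmap_pts[OF tp_iso_rmap[OF assms]] rmap_pts[OF q(1)]
    by (intro bij_betwI[of p _ _ q]) auto
qed

lemma tp_iso_id:
  assumes "truncation_poset S"
  shows "tp_iso S S (tp_id S)"
proof -
  interpret tposet S by standard fact
  have "rmap S S (tp_id S)"
    using rel_pts by (auto simp: rmap_def tp_id_def)
  moreover have "compose (pts S) (tp_id S) (tp_id S) = tp_id S"
    by (auto simp: compose_def tp_id_def)
  ultimately show ?thesis unfolding tp_iso_def by blast
qed

text \<open>Only part of the axioms is required of \<open>T\<close>, which will be a pullback.\<close>

lemma (in tposet) tp_iso_nrm:
  assumes p: "tp_iso S T p" and s: "s \<in> pts S"
    and dvd: "\<And>u t. (u, t) \<in> rel T \<Longrightarrow> nrm T u dvd nrm T t"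
    and min: "\<And>t. t \<in> pts T \<Longrightarrow> \<exists>u. (u, t) \<in> rel T \<and> nrm T u = 1"
  shows "nrm T (p s) = nrm S s"
proof (rule dvd_antisym)
  obtain q where q: "rmap T S q" "\<And>s. s \<in> pts S \<Longrightarrow> q (p s) = s"
    using tp_iso_obtain_inverse[OF p] by blast
  \<comment> \<open>Relative to a point of norm 1 the preserved quotient of \<open>p s\<close> is
    its norm, so \<open>|s| = |p s| * |q u|\<close>; the reverse divisibility is symmetric.\<close>
  obtain u where u: "(u, p s) \<in> rel T" "nrm T u = 1"
    using min rmap_pts[OF tp_iso_rmap[OF p] s] by blast
  show "nrm T (p s) dvd nrm S s"
    using rmap_nrm[OF q(1) u(1) rel_dvd[OF rmap_rel[OF q(1) u(1)]]] u(2) q(2)[OF s] by simp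
  obtain v where v: "(v, s) \<in> rel S" "nrm S v = 1"
    using ex_below[OF s, of 1] by auto
  show "nrm S s dvd nrm T (p s)"
    using rmap_nrm[OF tp_iso_rmap[OF p] v(1) dvd[OF rmap_rel[OF tp_iso_rmap[OF p] v(1)]]] v(2)
    by simp
qed

lemma tp_iso_nrm_tposet:
  assumes "truncation_poset S" "truncation_poset T" "tp_iso S T p" "s \<in> pts S"
  shows "nrm T (p s) = nrm S s"
proof -
  interpret S: tposet S by standard fact
  interpret T: tposet T by standard fact
  show ?thesis
    using T.rel_dvd T.ex_below[of _ 1] by (intro S.tp_iso_nrm[OF assms(3,4)]) auto
qed

lemma ghost_star_closed:
  "rmap S T f \<Longrightarrow> x \<in> witt T k \<Longrightarrow> ghost_star S T f x \<in> witt S k"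
  by (auto simp: ghost_star_def witt_def rmap_pts)

lemma ghost_star_id: "x \<in> witt S k \<Longrightarrow> ghost_star S S (tp_id S) x = x"
  by (auto simp: ghost_star_def tp_id_def witt_def fun_eq_iff PiE_iff extensional_def)

lemma ghost_star_comp:
  assumes "rmap S T f"
  shows "ghost_star S T f (ghost_star T U g x) = ghost_star S U (compose (pts S) g f) x"
  using rmap_pts[OF assms] by (auto simp: ghost_star_def compose_def fun_eq_iff)

lemma ghost_oplus_fibre:
  "ghost_oplus S T f k x =
    (\<lambda>t\<in>pts T. finsum k (\<lambda>s. [(nrm T t div nrm S s)] \<cdot>\<^bsub>k\<^esub> x s) (fibre S f t))"
  by (simp add: ghost_oplus_def fibre_def)

lemma ghost_oplus_closed:
  assumes "cring k" "x \<in> witt S k"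
  shows "ghost_oplus S T f k x \<in> witt T k"
proof -
  interpret cring k by fact
  have "x s \<in> carrier k" if "s \<in> pts S" for s
    using assms(2) that by (auto simp: witt_def)
  then show ?thesis
    by (auto simp: ghost_oplus_fibre witt_def fibre_def intro!: finsum_closed)
qed

lemma ghost_oplus_id:
  assumes "cring k" "truncation_poset S" "x \<in> witt S k"
  shows "ghost_oplus S S (tp_id S) k x = x"
proof -
  interpret cring k by fact
  interpret tposet S by standard fact
  have x: "x s \<in> carrier k" if "s \<in> pts S" for s
    using assms(3) that by (auto simp: witt_def)
  have "fibre S (tp_id S) s = {s}" if "s \<in> pts S" for s
    using that by (auto simp: fibre_def tp_id_def)
  moreover have "x s = undefined" if "s \<notin> pts S" for s
    using assms(3) that by (auto simp: witt_def PiE_iff extensional_def)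
  ultimately show ?thesis
    using x nrm_pos by (auto simp: ghost_oplus_fibre fun_eq_iff)
qed

lemma (in cring) add_pow_finsum:
  assumes "g \<in> A \<rightarrow> carrier R"
  shows "[(n::nat)] \<cdot> finsum R g A = finsum R (\<lambda>i. [n] \<cdot> g i) A"
  using assms
  by (induction A rule: infinite_finite_induct) (simp_all add: add.nat_pow_distrib Pi_iff)

text \<open>The fibre of the composite is the disjoint union of the fibres of \<open>f\<close> over
  the fibre of \<open>g\<close>, and \<open>|u| / |s|\<close> factors through
  \<open>|t|\<close>.\<close>

lemma ghost_oplus_comp:
  assumes k: "cring k" and "t_map S T f" "t_map T U g" and x: "x \<in> witt S k"
  shows "ghost_oplus T U g k (ghost_oplus S T f k x) = ghost_oplus S U (compose (pts S) g f) k x"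
proof -
  interpret cring k by (rule k)
  interpret f: t_map S T f by fact
  interpret g: t_map T U g by fact
  have xc: "x s \<in> carrier k" if "s \<in> pts S" for s
    using x that by (auto simp: witt_def)
  have "ghost_oplus T U g k (ghost_oplus S T f k x) u =
      ghost_oplus S U (compose (pts S) g f) k x u" if u: "u \<in> pts U" for u
  proof -
    have fin: "finite (fibre T g u)" "\<And>t. t \<in> fibre T g u \<Longrightarrow> finite (fibre S f t)"
      using g.tmap_finite_fibre[OF u] f.tmap_finite_fibre by (auto simp: fibre_def)
    have un: "fibre S (compose (pts S) g f) u = (\<Union>t\<in>fibre T g u. fibre S f t)"
      using rmap_pts[OF f.rmap] by (auto simp: fibre_def compose_def)
    have "ghost_oplus S U (compose (pts S) g f) k x u =
        finsum k (\<lambda>s. [(nrm U u div nrm S s)] \<cdot>\<^bsub>k\<^esub> x s) (\<Union>t\<in>fibre T g u. fibre S f t)"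
      using u by (simp add: ghost_oplus_fibre un)
    also have "\<dots> = finsum k (\<lambda>t. finsum k (\<lambda>s. [(nrm U u div nrm S s)] \<cdot>\<^bsub>k\<^esub> x s) (fibre S f t))
        (fibre T g u)"
      using fin xc by (intro add.finprod_UN_disjoint) (auto simp: pairwise_def disjnt_def fibre_def)
    also have "\<dots> = finsum k (\<lambda>t. [(nrm U u div nrm T t)] \<cdot>\<^bsub>k\<^esub> ghost_oplus S T f k x t) (fibre T g u)"
    proof (rule finsum_cong')
      show "(\<lambda>t. [(nrm U u div nrm T t)] \<cdot>\<^bsub>k\<^esub> ghost_oplus S T f k x t) \<in> fibre T g u \<rightarrow> carrier k"
        using ghost_oplus_closed[OF k x, of T f] by (auto simp: witt_def fibre_def)
      fix t assume t: "t \<in> fibre T g u"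
      have "finsum k (\<lambda>s. [(nrm U u div nrm S s)] \<cdot>\<^bsub>k\<^esub> x s) (fibre S f t) =
          finsum k (\<lambda>s. [(nrm U u div nrm T t)] \<cdot>\<^bsub>k\<^esub> ([(nrm T t div nrm S s)] \<cdot>\<^bsub>k\<^esub> x s)) (fibre S f t)"
      proof (rule finsum_cong')
        fix s assume s: "s \<in> fibre S f t"
        have "nrm T t > 0" using t f.T.nrm_pos by (auto simp: fibre_def)
        then have "nrm U u div nrm S s = nrm T t div nrm S s * (nrm U u div nrm T t)"
          using f.fibre_nrm_dvd[OF s] g.fibre_nrm_dvd[OF t] by (auto elim!: dvdE)
        then show "[(nrm U u div nrm S s)] \<cdot>\<^bsub>k\<^esub> x s =
            [(nrm U u div nrm T t)] \<cdot>\<^bsub>k\<^esub> ([(nrm T t div nrm S s)] \<cdot>\<^bsub>k\<^esub> x s)"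
          using s xc by (simp add: add.nat_pow_pow fibre_def)
      qed (use xc in \<open>auto simp: fibre_def\<close>)
      then show "finsum k (\<lambda>s. [(nrm U u div nrm S s)] \<cdot>\<^bsub>k\<^esub> x s) (fibre S f t) =
          [(nrm U u div nrm T t)] \<cdot>\<^bsub>k\<^esub> ghost_oplus S T f k x t"
        using t xc by (subst (asm) add_pow_finsum[symmetric]) (auto simp: ghost_oplus_fibre fibre_def)
    qed simp
    finally show ?thesis
      using u by (simp add: ghost_oplus_fibre)
  qed
  then show ?thesis
    by (intro extensionalityI[of _ "pts U"]) (auto simp: ghost_oplus_def)
qed

lemma ghost_star_iso:
  assumes "rmap S T f" "rmap S' T' f'" "rmap S S' q" "rmap T T' p"
    and "\<And>s. s \<in> pts S \<Longrightarrow> p (f s) = f' (q s)"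
  shows "ghost_star S T f (ghost_star T T' p x) = ghost_star S S' q (ghost_star S' T' f' x)"
  using rmap_pts[OF assms(1)] rmap_pts[OF assms(3)] assms(5)
  by (auto simp: ghost_star_def fun_eq_iff)

text \<open>Isomorphisms act through \<open>ghost_star\<close>, against their direction, for
  T-arrows too; the squares for both kinds of arrow then have one shape and can be pasted.\<close>

lemma ghost_oplus_iso:
  assumes k: "cring k" and f: "t_map S T f" and f': "t_map S' T' f'"
    and p: "tp_iso S S' p" and q: "tp_iso T T' q"
    and comm: "\<And>s. s \<in> pts S \<Longrightarrow> q (f s) = f' (p s)" and x: "x \<in> witt S' k"
  shows "ghost_oplus S T f k (ghost_star S S' p x) = ghost_star T T' q (ghost_oplus S' T' f' k x)"
proof -
  interpret cring k by (rule k)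
  interpret f: t_map S T f by fact
  interpret f': t_map S' T' f' by fact
  have xc: "x s \<in> carrier k" if "s \<in> pts S'" for s
    using x that by (auto simp: witt_def)
  note bp = tp_iso_bij_betw[OF p] and bq = tp_iso_bij_betw[OF q]
  note np = tp_iso_nrm_tposet[OF f.S.truncation_poset f'.S.truncation_poset p]
  note nq = tp_iso_nrm_tposet[OF f.T.truncation_poset f'.T.truncation_poset q]
  have "ghost_oplus S T f k (ghost_star S S' p x) t = ghost_star T T' q (ghost_oplus S' T' f' k x) t"
    if t: "t \<in> pts T" for t
  proof -
    have qt: "q t \<in> pts T'" using bq t by (auto simp: bij_betw_def)
    have "fibre S' f' (q t) = p ` fibre S f t"
    proof (intro equalityI subsetI)
      fix s' assume s': "s' \<in> fibre S' f' (q t)"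
      then obtain s where s: "s \<in> pts S" "s' = p s"
        using bp by (auto simp: fibre_def bij_betw_def)
      then have "q (f s) = q t"
        using s' comm by (simp add: fibre_def)
      then have "f s = t"
        using bq t rmap_pts[OF f.rmap s(1)] by (auto simp: bij_betw_def dest: inj_onD)
      then show "s' \<in> p ` fibre S f t"
        using s by (auto simp: fibre_def)
    qed (use bp comm in \<open>auto simp: fibre_def bij_betw_def\<close>)
    then have "finsum k (\<lambda>s'. [(nrm T' (q t) div nrm S' s')] \<cdot>\<^bsub>k\<^esub> x s') (fibre S' f' (q t)) =
        finsum k (\<lambda>s. [(nrm T' (q t) div nrm S' (p s))] \<cdot>\<^bsub>k\<^esub> x (p s)) (fibre S f t)"
      using bp xc
      by (simp, intro finsum_reindex) (auto simp: fibre_def bij_betw_def intro: inj_on_subset)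
    also have "\<dots> = finsum k (\<lambda>s. [(nrm T t div nrm S s)] \<cdot>\<^bsub>k\<^esub> ghost_star S S' p x s) (fibre S f t)"
      using xc bij_betwE[OF bp] np nq[OF t]
      by (intro finsum_cong') (auto simp: fibre_def ghost_star_def)
    finally show ?thesis
      using t qt by (simp add: ghost_oplus_fibre ghost_star_def)
  qed
  then show ?thesis
    by (intro extensionalityI[of _ "pts T"]) (auto simp: ghost_oplus_def ghost_star_def)
qed

text \<open>The counting identity for the pullback: \<open>a\<close> and \<open>b\<close> are the
  norms of the two points, \<open>n\<close> that of their common image. With
  \<open>c = n / a\<close> and \<open>d = n / b\<close> one has
  \<open>gcd c d * b = gcd (c * b) (d * b)\<close>, and \<open>d * b = n = c * a\<close>.\<close>

lemma gcd_div_mult_div_gcd: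
  fixes a b n :: nat
  assumes "a > 0" "a dvd n" "b dvd n"
  shows "gcd (n div a) (n div b) * (b div gcd a b) = n div a"
proof -
  obtain c where c: "n = a * c"
    using assms(2) by (rule dvdE)
  obtain d where d: "n = b * d"
    using assms(3) by (rule dvdE)
  show ?thesis
  proof (cases "b = 0")
    case True
    then show ?thesis using c d assms(1) by simp
  next
    case False
    have "gcd c d * b = gcd (c * b) (c * a)"
      using c d by (metis gcd_mult_distrib_nat mult.commute)
    also have "\<dots> = c * gcd a b"
      by (metis gcd.commute gcd_mult_distrib_nat)
    finally have "gcd c d * (b div gcd a b) * gcd a b = c * gcd a b"
      by (simp add: mult.assoc)
    moreover have "n div a = c"
      using c assms(1) by simp
    moreover have "n div b = d"
      using d False by simp
    ultimately show ?thesis using assms(1) by simp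
  qed
qed

lemma pullback_simps:
  "(x, y, i) \<in> pts (pullback B C A f g) \<longleftrightarrow> x \<in> pts B \<and> y \<in> pts C \<and> f x = g y \<and>
     i \<in> carrier (integer_mod_group (gcd (nrm A (f x) div nrm B x) (nrm A (g y) div nrm C y)))"
  "((x, y, i), (x', y', i')) \<in> rel (pullback B C A f g) \<longleftrightarrow>
     (x, y, i) \<in> pts (pullback B C A f g) \<and> (x', y', i') \<in> pts (pullback B C A f g) \<and>
     (x, x') \<in> rel B \<and> (y, y') \<in> rel C \<and> i = i'"
  "(x, y, i) \<in> pts (pullback B C A f g) \<Longrightarrow>
     nrm (pullback B C A f g) (x, y, i) = gcd (nrm B x) (nrm C y)"
  by (auto simp: pullback_def Let_def)

text \<open>Points over \<open>y\<close> are grouped by their first projection \<open>x\<close>. A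
  group has as many points as the cyclic group, all with the same summand, and
  \<open>gcd_div_mult_div_gcd\<close> turns the total into the coefficient
  \<open>|g y| / |x|\<close>.\<close>

lemma ghost_exchange:
  assumes k: "cring k" and P: "truncation_poset P" and f: "t_map B A f" and g: "r_map C A g"
    and p: "tp_iso P (pullback B C A f g) p" and v: "v \<in> witt B k"
  shows "ghost_star C A g (ghost_oplus B A f k v) =
    ghost_oplus P C (\<lambda>z\<in>pts P. fst (snd (p z))) k (ghost_star P B (\<lambda>z\<in>pts P. fst (p z)) v)"
proof -
  interpret cring k by (rule k)
  interpret f: t_map B A f by fact
  interpret g: r_map C A g by fact
  interpret P: tposet P by standard (rule P)
  let ?Q = "pullback B C A f g"
  let ?m = "\<lambda>x y. gcd (nrm A (f x) div nrm B x) (nrm A (g y) div nrm C y)"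
  have vc: "v x \<in> carrier k" if "x \<in> pts B" for x
    using v that by (auto simp: witt_def)
  note bp = tp_iso_bij_betw[OF p]
  have nrm_p: "nrm ?Q (p z) = nrm P z" if "z \<in> pts P" for z
  proof (rule P.tp_iso_nrm[OF p that])
    fix u t assume "(u, t) \<in> rel ?Q"
    then show "nrm ?Q u dvd nrm ?Q t"
      using f.S.rel_dvd g.S.rel_dvd
      by (cases u, cases t) (auto simp: pullback_simps intro: dvd_trans)
  next
    fix t assume "t \<in> pts ?Q"
    then obtain x y i where t: "t = (x, y, i)" "x \<in> pts B" "y \<in> pts C" "f x = g y"
      "i \<in> carrier (integer_mod_group (?m x y))"
      by (cases t) (auto simp: pullback_simps)
    \<comment> \<open>Dividing \<open>x\<close> and \<open>y\<close> by the gcd of their norms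
      leaves coprime norms, hence a point of norm 1, provided the label \<open>i\<close> stays
      admissible.\<close>
    define n where "n = gcd (nrm B x) (nrm C y)"
    have n: "n > 0" "n dvd nrm B x" "n dvd nrm C y"
      using f.S.nrm_pos[OF t(2)] by (simp_all add: n_def)
    obtain x' where x': "(x', x) \<in> rel B" "nrm B x' = nrm B x div n"
      using f.S.ex_below[OF t(2), of "nrm B x div n"] n(2) by (metis dvd_div_mult_self dvd_triv_left)
    obtain y' where y': "(y', y) \<in> rel C" "nrm C y' = nrm C y div n"
      using g.S.ex_below[OF t(3), of "nrm C y div n"] n(3) by (metis dvd_div_mult_self dvd_triv_left)
    have nx: "nrm B x = n * nrm B x'" and ny: "nrm C y = n * nrm C y'"
      using x'(2) y'(2) n by simp_all
    have fx: "nrm A (f x) = n * nrm A (f x')" and gy: "nrm A (g y) = n * nrm A (g y')"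
      using f.rmap_nrm_mult[OF x'(1) nx] g.rmap_nrm_mult[OF y'(1) ny] by simp_all
    \<comment> \<open>Both images lie below \<open>f x = g y\<close>, so equal norms identify
      them.\<close>
    have "nrm A (f x') = nrm A (g y')"
      using fx gy t(4) n by (metis mult_cancel1 not_gr_zero)
    then have "f x' = g y'"
      using f.T.below_unique[of "f x'" "f x" "g y'"] rmap_rel[OF f.rmap x'(1)]
        rmap_rel[OF g.rmap y'(1)] t(4) by simp
    \<comment> \<open>Numerators and denominators lose the same factor \<open>n\<close>, so the
      cyclic group is unchanged.\<close>
    moreover have "?m x' y' = ?m x y"
      using n(1) by (simp add: fx gy nx ny)
    ultimately have u: "(x', y', i) \<in> pts ?Q"
      using t f.S.rel_pts[OF x'(1)] g.S.rel_pts[OF y'(1)] by (simp add: pullback_simps)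
    have "gcd (nrm B x') (nrm C y') = 1"
      using x'(2) y'(2) n(1) unfolding n_def by (intro coprime_imp_gcd_eq_1) (simp add: div_gcd_coprime)
    then have "nrm ?Q (x', y', i) = 1"
      using pullback_simps(3)[OF u] by simp
    moreover have "(x, y, i) \<in> pts ?Q"
      using t by (simp add: pullback_simps(1))
    then have "((x', y', i), t) \<in> rel ?Q"
      using u x'(1) y'(1) unfolding t(1) pullback_simps(2) by blast
    ultimately show "\<exists>u. (u, t) \<in> rel ?Q \<and> nrm ?Q u = 1" by blast
  qed
  define pr\<^sub>1 where "pr\<^sub>1 = (\<lambda>z\<in>pts P. fst (p z))"
  define pr\<^sub>2 where "pr\<^sub>2 = (\<lambda>z\<in>pts P. fst (snd (p z)))"
  have p_in: "p z \<in> pts ?Q" if "z \<in> pts P" for z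
    using bp that by (auto simp: bij_betw_def)
  have pr: "pr\<^sub>1 z \<in> pts B" "pr\<^sub>2 z \<in> pts C" "f (pr\<^sub>1 z) = g (pr\<^sub>2 z)"
    "\<exists>i\<in>carrier (integer_mod_group (?m (pr\<^sub>1 z) (pr\<^sub>2 z))). p z = (pr\<^sub>1 z, pr\<^sub>2 z, i)"
    if "z \<in> pts P" for z
    using p_in[OF that] that by (cases "p z"; simp add: pr\<^sub>1_def pr\<^sub>2_def pullback_simps(1))+
  have "ghost_oplus P C pr\<^sub>2 k (ghost_star P B pr\<^sub>1 v) y = ghost_star C A g (ghost_oplus B A f k v) y"
    if y: "y \<in> pts C" for y
  proof -
    have gy: "g y \<in> pts A" using rmap_pts[OF g.rmap y] .
    define F where "F = (\<lambda>x. {z \<in> pts P. pr\<^sub>1 z = x \<and> pr\<^sub>2 z = y})"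
    let ?c = "\<lambda>x. [(nrm C y div gcd (nrm B x) (nrm C y))] \<cdot>\<^bsub>k\<^esub> v x"
    have un: "fibre P pr\<^sub>2 y = (\<Union>x\<in>fibre B f (g y). F x)"
      using pr by (auto simp: F_def fibre_def)
    have F: "finite (F x) \<and> card (F x) = ?m x y" if x: "x \<in> fibre B f (g y)" for x
    proof -
      have xX: "x \<in> pts B" "f x = g y" using x by (auto simp: fibre_def)
      \<comment> \<open>Positivity matters: \<open>integer_mod_group 0\<close> consists of all
        integers and would make the group of points infinite.\<close>
      have pos: "?m x y > 0"
        using f.fibre_nrm_dvd[OF x] f.S.nrm_pos[OF xX(1)] f.T.nrm_pos[OF gy] xX
        by (auto elim!: dvdE)
      have carr: "carrier (integer_mod_group (?m x y)) = {0..<int (?m x y)}"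
        unfolding carrier_integer_mod_group by (rule if_not_P) (use pos in linarith)
      have "p ` F x = {x} \<times> {y} \<times> {0..<int (?m x y)}"
      proof (intro equalityI subsetI)
        fix w assume "w \<in> p ` F x"
        then obtain z where z: "z \<in> pts P" "pr\<^sub>1 z = x" "pr\<^sub>2 z = y" and w: "w = p z"
          by (auto simp: F_def)
        show "w \<in> {x} \<times> {y} \<times> {0..<int (?m x y)}"
          using pr(4)[OF z(1)] unfolding z(2,3) w carr by auto
      next
        fix w assume w: "w \<in> {x} \<times> {y} \<times> {0..<int (?m x y)}"
        then have "w \<in> pts ?Q"
          using y xX(1) carr by (auto simp: pullback_simps(1) xX(2))
        then obtain z where "z \<in> pts P" "w = p z"
          using bp by (auto simp: bij_betw_def)
        then show "w \<in> p ` F x"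
          using w by (auto simp: F_def pr\<^sub>1_def pr\<^sub>2_def)
      qed
      moreover have "inj_on p (F x)"
        using bp by (auto simp: bij_betw_def F_def intro: inj_on_subset)
      ultimately show ?thesis
        using card_image[of p "F x"] finite_imageD[of p "F x"] by (simp add: card_cartesian_product)
    qed
    have summand: "[(nrm C y div nrm P z)] \<cdot>\<^bsub>k\<^esub> ghost_star P B pr\<^sub>1 v z = ?c x" if z: "z \<in> F x" for z x
    proof -
      obtain i where i: "z \<in> pts P" "p z = (x, y, i)"
        using z pr(4)[of z] by (auto simp: F_def)
      then show ?thesis
        using nrm_p[OF i(1)] p_in[OF i(1)] by (simp add: pullback_simps(3) ghost_star_def pr\<^sub>1_def)
    qed
    have "ghost_oplus P C pr\<^sub>2 k (ghost_star P B pr\<^sub>1 v) y =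
        finsum k (\<lambda>z. [(nrm C y div nrm P z)] \<cdot>\<^bsub>k\<^esub> ghost_star P B pr\<^sub>1 v z) (\<Union>x\<in>fibre B f (g y). F x)"
      using y by (simp add: ghost_oplus_fibre un)
    also have "\<dots> = finsum k (\<lambda>x. finsum k
        (\<lambda>z. [(nrm C y div nrm P z)] \<cdot>\<^bsub>k\<^esub> ghost_star P B pr\<^sub>1 v z) (F x)) (fibre B f (g y))"
      using f.tmap_finite_fibre[OF gy] F summand vc
      by (intro add.finprod_UN_disjoint) (auto simp: pairwise_def disjnt_def fibre_def F_def)
    also have "\<dots> = finsum k (\<lambda>x. [(nrm A (g y) div nrm B x)] \<cdot>\<^bsub>k\<^esub> v x) (fibre B f (g y))"
    proof (rule finsum_cong')
      fix x assume x: "x \<in> fibre B f (g y)"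
      then have xX: "x \<in> pts B" "f x = g y" by (auto simp: fibre_def)
      have "finsum k (\<lambda>z. [(nrm C y div nrm P z)] \<cdot>\<^bsub>k\<^esub> ghost_star P B pr\<^sub>1 v z) (F x) =
          finsum k (\<lambda>z. ?c x) (F x)"
        using summand vc[OF xX(1)] by (intro finsum_cong') auto
      also have "\<dots> = [?m x y] \<cdot>\<^bsub>k\<^esub> ?c x"
        using F[OF x] vc[OF xX(1)] by (simp add: add.finprod_const)
      also have "\<dots> = [(nrm A (g y) div nrm B x)] \<cdot>\<^bsub>k\<^esub> v x"
        using gcd_div_mult_div_gcd[OF f.S.nrm_pos[OF xX(1)] f.rmap_nrm_dvd[OF xX(1)], of "nrm C y"]
          g.rmap_nrm_dvd[OF y] xX vc
        by (simp add: add.nat_pow_pow mult.commute)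
      finally show "finsum k (\<lambda>z. [(nrm C y div nrm P z)] \<cdot>\<^bsub>k\<^esub> ghost_star P B pr\<^sub>1 v z) (F x) =
          [(nrm A (g y) div nrm B x)] \<cdot>\<^bsub>k\<^esub> v x" .
    qed (use vc in \<open>auto simp: fibre_def\<close>)
    finally show ?thesis
      using y gy by (simp add: ghost_star_def ghost_oplus_fibre)
  qed
  then show ?thesis
    unfolding pr\<^sub>1_def pr\<^sub>2_def
    by (intro extensionalityI[of _ "pts C"]) (auto simp: ghost_oplus_def ghost_star_def)
qed

section \<open>The action of diagrams\<close>

lemma lifts_id: "lifts S S (\<lambda>k x. x) (\<lambda>k\<in>{k. cring k}. \<lambda>a\<in>witt S k. a)"
  by (auto simp: lifts_def natural_witt_map_def witt_compose)

lemma lifts_witt: "lifts S T G F \<Longrightarrow> cring k \<Longrightarrow> F k \<in> witt S k \<rightarrow>\<^sub>E witt T k"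
  unfolding lifts_def natural_witt_map_def by (auto simp: PiE_iff)

lemma lifts_comp:
  assumes F: "lifts S T G F" and F': "lifts T U G' F'"
  shows "lifts S U (\<lambda>k x. G' k (G k x)) (\<lambda>k\<in>{k. cring k}. compose (witt S k) (F' k) (F k))"
proof -
  have w: "F k a \<in> witt T k" "F' k (F k a) \<in> witt U k" if "cring k" "a \<in> witt S k" for k a
    using lifts_witt[OF F that(1)] lifts_witt[OF F' that(1)] that(2) by (auto simp: PiE_iff)
  define H where "H = (\<lambda>k\<in>{k. cring k}. compose (witt S k) (F' k) (F k))"
  have H: "H k a = F' k (F k a)" if "cring k" "a \<in> witt S k" for k a
    using that by (simp add: H_def compose_def)
  have "H \<in> (\<Pi>\<^sub>E k\<in>{k. cring k}. witt S k \<rightarrow>\<^sub>E witt U k)"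
    using w unfolding H_def by (auto simp: compose_def)
  moreover have "H k' (compose (pts S) h a) = compose (pts U) h (H k a)"
    if k: "cring k" "cring k'" and h: "h \<in> ring_hom k k'" and a: "a \<in> witt S k" for k k' h a
  proof -
    have "F k' (compose (pts S) h a) = compose (pts T) h (F k a)"
      using F k h a unfolding lifts_def natural_witt_map_def by blast
    moreover have "F' k' (compose (pts T) h (F k a)) = compose (pts U) h (F' k (F k a))"
      using F' k h w(1)[OF k(1) a] unfolding lifts_def natural_witt_map_def by blast
    ultimately show ?thesis
      using H[OF k(1) a] H[OF k(2) witt_compose[OF h a]] by simp
  qed
  moreover have "ghost U k (H k a) = G' k (G k (ghost S k a))"
    if "cring k" "a \<in> witt S k" for k a
    using F F' that w(1)[OF that] H[OF that] unfolding lifts_def by metis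
  ultimately show ?thesis
    unfolding H_def[symmetric] lifts_def natural_witt_map_def by blast
qed

fun arrow_ghost :: "'u arrow \<Rightarrow> 'r ring \<Rightarrow> ('u \<Rightarrow> 'r) \<Rightarrow> ('u \<Rightarrow> 'r)" where
  "arrow_ghost (TArr S T f) k = ghost_oplus S T f k"
| "arrow_ghost (RArr S T f) k = ghost_star S T f"

fun arrow_map :: "'u arrow \<Rightarrow> 'r ring \<Rightarrow> ('u \<Rightarrow> 'r) \<Rightarrow> ('u \<Rightarrow> 'r)" where
  "arrow_map (TArr S T f) = oplus_map S T f"
| "arrow_map (RArr S T f) = star_map S T f"

fun diagram_ghost :: "'u arrow list \<Rightarrow> 'r ring \<Rightarrow> ('u \<Rightarrow> 'r) \<Rightarrow> ('u \<Rightarrow> 'r)" where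
  "diagram_ghost [] k x = x"
| "diagram_ghost (a # as) k x = diagram_ghost as k (arrow_ghost a k x)"

text \<open>The source is an argument so that the empty list can act as the identity restricted to
  \<open>witt S k\<close>.\<close>

fun diagram_map :: "'u tposet \<Rightarrow> 'u arrow list \<Rightarrow> 'r ring \<Rightarrow> ('u \<Rightarrow> 'r) \<Rightarrow> ('u \<Rightarrow> 'r)" where
  "diagram_map S [] k = (\<lambda>a\<in>witt S k. a)"
| "diagram_map S (a # as) k = compose (witt S k) (diagram_map (atgt a) as k) (arrow_map a k)"

lemma t_mapI: "truncation_poset S \<Longrightarrow> truncation_poset T \<Longrightarrow> tmap S T f \<Longrightarrow> t_map S T f"
  by unfold_locales

lemma r_mapI: "truncation_poset S \<Longrightarrow> truncation_poset T \<Longrightarrow> rmap S T f \<Longrightarrow> r_map S T f"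
  by unfold_locales

lemma arrow_map_lifts:
  assumes "infinite (UNIV :: 'r set)" "arrow_ok a"
  shows "lifts (asrc a) (atgt a) (arrow_ghost a) (arrow_map a :: 'r ring \<Rightarrow> _)"
proof (cases a)
  case (TArr S T f)
  then have "t_map S T f" using assms(2) by (simp add: t_mapI)
  moreover have "arrow_ghost a = (ghost_oplus S T f :: 'r ring \<Rightarrow> _)"
    using TArr by (simp add: fun_eq_iff)
  ultimately show ?thesis
    using t_map.oplus_map_lifts[OF _ assms(1)] TArr by simp
next
  case (RArr S T f)
  then have "r_map S T f" using assms(2) by (simp add: r_mapI)
  moreover have "arrow_ghost a = (\<lambda>k :: 'r ring. ghost_star S T f)"
    using RArr by (simp add: fun_eq_iff)
  ultimately show ?thesis
    using r_map.star_map_lifts[OF _ assms(1)] RArr by simp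
qed

lemma path_append: "path S (d @ e) T \<longleftrightarrow> (\<exists>U. path S d U \<and> path U e T)"
  by (induction d arbitrary: S) auto

lemma path_unique: "path S d T \<Longrightarrow> path S d T' \<Longrightarrow> T = T'"
  by (induction d arbitrary: S) auto

text \<open>Makes the action of a diagram on Witt vectors subject to \<open>lifts_unique\<close>.
  The restriction to commutative rings supplies the extensionality in
  \<open>natural_witt_map\<close>.\<close>

lemma diagram_map_lifts:
  assumes "infinite (UNIV :: 'r set)" "path S d T"
  shows "lifts S T (diagram_ghost d) (\<lambda>k\<in>{k :: 'r ring. cring k}. diagram_map S d k)"
  using assms(2)
proof (induction d arbitrary: S)
  case Nil
  have "diagram_ghost [] = (\<lambda>(k :: 'r ring) (x :: 'a \<Rightarrow> 'r). x)" by (simp add: fun_eq_iff)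
  moreover have "S = T" using Nil by simp
  ultimately show ?case using lifts_id[of S] by (simp only: diagram_map.simps)
next
  case (Cons a d)
  then have a: "arrow_ok a" "asrc a = S" and d: "path (atgt a) d T" by auto
  have "lifts S T (\<lambda>k x. diagram_ghost d k (arrow_ghost a k x))
      (\<lambda>k\<in>{k :: 'r ring. cring k}. compose (witt S k)
        ((\<lambda>k\<in>{k :: 'r ring. cring k}. diagram_map (atgt a) d k) k) (arrow_map a k))"
    using lifts_comp[OF arrow_map_lifts[OF assms(1) a(1)] Cons.IH[OF d]] a(2) by simp
  moreover have "diagram_ghost (a # d) = (\<lambda>(k :: 'r ring) x. diagram_ghost d k (arrow_ghost a k x))"
    by (simp add: fun_eq_iff)
  moreover have "(\<lambda>k\<in>{k :: 'r ring. cring k}. compose (witt S k)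
        ((\<lambda>k\<in>{k :: 'r ring. cring k}. diagram_map (atgt a) d k) k) (arrow_map a k)) =
      (\<lambda>k\<in>{k. cring k}. diagram_map S (a # d) k)"
    by (auto simp: fun_eq_iff)
  ultimately show ?case by (simp only:)
qed

lemma diagram_map_witt:
  assumes "infinite (UNIV :: 'r set)" "path S d T" "cring (k :: 'r ring)"
  shows "diagram_map S d k \<in> witt S k \<rightarrow>\<^sub>E witt T k"
  using lifts_witt[OF diagram_map_lifts[OF assms(1,2)] assms(3)] assms(3) by simp

lemma diagram_map_append:
  assumes inf: "infinite (UNIV :: 'r set)" and k: "cring (k :: 'r ring)"
    and "path S d T" "path T e U"
  shows "diagram_map S (d @ e) k = compose (witt S k) (diagram_map T e k) (diagram_map S d k)"
  using assms(3)
proof (induction d arbitrary: S)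
  case Nil
  then show ?case
    using diagram_map_witt[OF inf assms(4) k]
    by (auto simp: compose_def fun_eq_iff PiE_iff extensional_def)
next
  case (Cons a d)
  then have a: "arrow_ok a" "asrc a = S" and d: "path (atgt a) d T" by auto
  have "arrow_map a k \<in> witt S k \<rightarrow>\<^sub>E witt (atgt a) k"
    using lifts_witt[OF arrow_map_lifts[OF inf a(1)] k] a(2) by simp
  then show ?case
    using Cons.IH[OF d] by (auto simp: compose_def fun_eq_iff PiE_iff)
qed

lemma diagram_map_single:
  assumes "infinite (UNIV :: 'r set)" "cring (k :: 'r ring)" "arrow_ok a"
  shows "diagram_map (asrc a) [a] k = arrow_map a k"
  using lifts_witt[OF arrow_map_lifts[OF assms(1,3)] assms(2)]
  by (auto simp: compose_def fun_eq_iff PiE_iff extensional_def)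

lemma diagram_ghost_append: "diagram_ghost (d @ e) k x = diagram_ghost e k (diagram_ghost d k x)"
  by (induction d arbitrary: x) auto

lemma arrow_ghost_closed:
  assumes "cring k" "arrow_ok a" "x \<in> witt (asrc a) k"
  shows "arrow_ghost a k x \<in> witt (atgt a) k"
  using assms by (cases a) (auto simp: ghost_oplus_closed ghost_star_closed)

lemma diagram_ghost_closed:
  "cring k \<Longrightarrow> path S d T \<Longrightarrow> x \<in> witt S k \<Longrightarrow> diagram_ghost d k x \<in> witt T k"
proof (induction d arbitrary: S x)
  case (Cons a d)
  then show ?case
    using Cons.IH[of "atgt a" "arrow_ghost a k x"] arrow_ghost_closed[of k a x] by auto
qed simp

section \<open>Invariance of the ghost action under the generating moves\<close>

lemma arrow_ghost_iso:
  assumes "cring k" "arrow_iso p a b q" "arrow_ok a" "arrow_ok b" "x \<in> witt (asrc b) k"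
  shows "arrow_ghost a k (ghost_star (asrc a) (asrc b) p x) =
    ghost_star (atgt a) (atgt b) q (arrow_ghost b k x)"
proof (cases a)
  case a: (TArr S T f)
  show ?thesis
  proof (cases b)
    case b: (TArr S' T' f')
    show ?thesis
      using assms unfolding a b by (auto intro!: ghost_oplus_iso t_mapI)
  qed (use assms a in simp)
next
  case a: (RArr S T f)
  show ?thesis
  proof (cases b)
    case b: (RArr S' T' f')
    show ?thesis
      using assms unfolding a b by (auto intro!: ghost_star_iso dest: tp_iso_rmap)
  qed (use assms a in simp)
qed

text \<open>Pasting squares arrow by arrow passes through arbitrary isomorphisms at the inner
  objects, so the ends are general as well.\<close>

lemma diag_iso_ghost:
  assumes k: "cring k"
  shows "diag_iso p d e q \<Longrightarrow> path S d T \<Longrightarrow> path S' e T' \<Longrightarrow> x \<in> witt S' k \<Longrightarrow>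
    diagram_ghost d k (ghost_star S S' p x) = ghost_star T T' q (diagram_ghost e k x)"
proof (induction arbitrary: S S' x rule: diag_iso.induct)
  case (single p a b q)
  then show ?case using arrow_ghost_iso[OF k, of p a b q x] by auto
next
  case (cons p a b q as bs r)
  then have ab: "arrow_ok a" "asrc a = S" "arrow_ok b" "asrc b = S'" by auto
  then have "arrow_ghost a k (ghost_star S S' p x) =
      ghost_star (atgt a) (atgt b) q (arrow_ghost b k x)"
    using arrow_ghost_iso[OF k cons.hyps(1)] cons.prems by auto
  moreover have "arrow_ghost b k x \<in> witt (atgt b) k"
    using arrow_ghost_closed[OF k, of b x] ab cons.prems by auto
  ultimately show ?case
    using cons.IH[of "atgt a" "atgt b" "arrow_ghost b k x"] cons.prems by auto
qed

text \<open>Serves every move except \<open>iso\<close>. The target of a path is determined by its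
  source and arrows, so both middle segments start at the same poset and act on the same
  vector.\<close>

lemma diagram_ghost_replace:
  assumes k: "cring k" and path: "path S (d @ m @ e) T" "path S (d @ m' @ e) T"
    and x: "x \<in> witt S k"
    and eq: "\<And>U V V' w. path U m V \<Longrightarrow> path U m' V' \<Longrightarrow> w \<in> witt U k \<Longrightarrow>
      diagram_ghost m k w = diagram_ghost m' k w"
  shows "diagram_ghost (d @ m @ e) k x = diagram_ghost (d @ m' @ e) k x"
proof -
  obtain U V where U: "path S d U" "path U m V"
    using path(1) by (auto simp: path_append)
  obtain U' V' where U': "path S d U'" "path U' m' V'"
    using path(2) by (auto simp: path_append)
  have "diagram_ghost m k (diagram_ghost d k x) = diagram_ghost m' k (diagram_ghost d k x)"
    using eq U U' path_unique[OF U(1) U'(1)] diagram_ghost_closed[OF k U(1) x] by blast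
  then show ?thesis by (simp add: diagram_ghost_append)
qed

text \<open>A diagram is nonempty, so each end belongs to an arrow, and arrows join truncation
  posets.\<close>

lemma diagrams_tposet:
  assumes "d \<in> diagrams S T"
  shows "truncation_poset S" "truncation_poset T"
proof -
  have ok: "truncation_poset (asrc a) \<and> truncation_poset (atgt a)" if "arrow_ok a"
    for a :: "'a arrow"
    using that by (cases a) auto
  have "path S d T \<Longrightarrow> d \<noteq> [] \<Longrightarrow> truncation_poset S \<and> truncation_poset T"
  proof (induction d arbitrary: S)
    case (Cons a d)
    then show ?case using ok[of a] by (cases "d = []") auto
  qed simp
  then show "truncation_poset S" "truncation_poset T"
    using assms by (auto simp: diagrams_def)
qed

lemma diag_move_ghost:
  assumes k: "cring k" and "d \<in> diagrams S T" "e \<in> diagrams S T" and x: "x \<in> witt S k"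
    and "diag_move S T d e"
  shows "diagram_ghost d k x = diagram_ghost e k x"
  using assms(5,2,3)
proof (induction rule: diag_move.induct)
  case (iso d e)
  then have p: "path S d T" "path S e T" by (auto simp: diagrams_def)
  show ?case
    using diag_iso_ghost[OF k iso.hyps p x] x diagram_ghost_closed[OF k p(2) x]
    by (simp add: ghost_star_id)
next
  \<comment> \<open>Inserting an identity is the replacement of an empty segment.\<close>
  case (ident_T d e A)
  then show ?case
    using x by (intro diagram_ghost_replace[OF k, where m = "[]" and S = S and T = T, simplified])
      (auto simp: diagrams_def ghost_oplus_id[OF k])
next
  case (ident_R d e A)
  then show ?case
    using x by (intro diagram_ghost_replace[OF k, where m = "[]" and S = S and T = T, simplified])
      (auto simp: diagrams_def ghost_star_id)
next
  case (comp_T d A B f C g e)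
  then show ?case
    using x by (intro diagram_ghost_replace[OF k, where S = S and T = T])
      (auto simp: diagrams_def ghost_oplus_comp[OF k] t_mapI)
next
  case (comp_R d B C g A f e)
  then show ?case
    using x by (intro diagram_ghost_replace[OF k, where S = S and T = T])
      (auto simp: diagrams_def ghost_star_comp)
next
  case (exchange P B C A f g p d e)
  then show ?case
    using x by (intro diagram_ghost_replace[OF k, where S = S and T = T])
      (auto simp: diagrams_def ghost_exchange[OF k] t_mapI r_mapI)
qed

text \<open>Equal ghost actions over \<open>k\<close> alone would not suffice, as the ghost map
  there need not be injective. They are compared over all commutative rings of the type, and
  \<open>k\<close> is inserted last.\<close>

lemma diagram_map_cong:
  assumes inf: "infinite (UNIV :: 'r set)" and k: "cring (k :: 'r ring)"
    and de: "(d, e) \<in> diag_rel S T"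
  shows "diagram_map S d k = diagram_map S e k"
proof -
  have d: "d \<in> diagrams S T" and e: "e \<in> diagrams S T" and
    eq: "equivclp (\<lambda>x y. x \<in> diagrams S T \<and> y \<in> diagrams S T \<and> diag_move S T x y) d e"
    using de by (auto simp: diag_rel_def)
  have "diagram_ghost d k' x = diagram_ghost e k' x" if "cring k'" "x \<in> witt S k'"
    for k' :: "'r ring" and x
    using eq by (induction rule: equivclp_induct) (use diag_move_ghost[OF that(1) _ _ that(2)] in metis)+
  then have "(\<lambda>k\<in>{k :: 'r ring. cring k}. diagram_map S d k) = (\<lambda>k\<in>{k. cring k}. diagram_map S e k)"
    using lifts_unique[OF inf diagrams_tposet(2)[OF d] diagram_map_lifts[OF inf]
        diagram_map_lifts[OF inf]] d e
    by (auto simp: diagrams_def)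
  from fun_cong[OF this, of k] show ?thesis using k by simp
qed

section \<open>Categories of truncation posets\<close>

lemma equiv_diag_rel: "equiv (diagrams S T) (diag_rel S T)"
proof (rule equivI)
  show "diag_rel S T \<subseteq> diagrams S T \<times> diagrams S T"
    by (auto simp: diag_rel_def)
  show "refl_on (diagrams S T) (diag_rel S T)"
    by (auto simp: diag_rel_def refl_on_def)
  show "sym (diag_rel S T)"
    by (auto simp: diag_rel_def sym_def intro: equivclp_sym)
  show "trans (diag_rel S T)"
    by (auto simp: diag_rel_def trans_def intro: equivclp_trans)
qed

lemma diag_rel_move:
  "d \<in> diagrams S T \<Longrightarrow> e \<in> diagrams S T \<Longrightarrow> diag_move S T d e \<Longrightarrow> (d, e) \<in> diag_rel S T"
  by (auto simp: diag_rel_def)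

lemma diag_rel_trans: "(d, e) \<in> diag_rel S T \<Longrightarrow> (e, c) \<in> diag_rel S T \<Longrightarrow> (d, c) \<in> diag_rel S T"
  using equiv_diag_rel by (meson equivE transD)

lemma diag_class_eqI: "(d, e) \<in> diag_rel S T \<Longrightarrow> diag_class S T d = diag_class S T e"
  unfolding diag_class_def by (rule equiv_class_eq[OF equiv_diag_rel])

lemma diag_class_move:
  "d \<in> diagrams S T \<Longrightarrow> e \<in> diagrams S T \<Longrightarrow> diag_move S T d e \<Longrightarrow>
    diag_class S T d = diag_class S T e"
  by (intro diag_class_eqI diag_rel_move)

lemma diagrams_append: "d \<in> diagrams S T \<Longrightarrow> e \<in> diagrams T U \<Longrightarrow> d @ e \<in> diagrams S U"
  by (auto simp: diagrams_def path_append)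

lemma diag_iso_append:
  "diag_iso p d d' q \<Longrightarrow> diag_iso q e e' r \<Longrightarrow> diag_iso p (d @ e) (d' @ e') r"
  by (induction rule: diag_iso.induct) (auto intro: diag_iso.cons)

lemma arrow_iso_id: "arrow_ok a \<Longrightarrow> arrow_iso (tp_id (asrc a)) a a (tp_id (atgt a))"
proof (cases a)
  case (TArr S T f)
  moreover have "f s \<in> pts T" if "arrow_ok a" "s \<in> pts S" for s
    using that TArr rmap_pts[of S T f s] by (simp add: tmap_def)
  ultimately show "arrow_ok a \<Longrightarrow> ?thesis"
    by (simp add: tp_iso_id) (simp add: tp_id_def)
next
  case (RArr S T f)
  moreover have "f s \<in> pts T" if "arrow_ok a" "s \<in> pts S" for s
    using that RArr rmap_pts[of S T f s] by simp
  ultimately show "arrow_ok a \<Longrightarrow> ?thesis"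
    by (simp add: tp_iso_id) (simp add: tp_id_def)
qed

lemma diag_iso_id: "d \<in> diagrams S T \<Longrightarrow> diag_iso (tp_id S) d d (tp_id T)"
proof (induction d arbitrary: S)
  case (Cons a d)
  then have a: "arrow_iso (tp_id S) a a (tp_id (atgt a))"
    using arrow_iso_id[of a] by (auto simp: diagrams_def)
  show ?case
  proof (cases "d = []")
    case True
    then show ?thesis using Cons.prems a by (auto simp: diagrams_def intro: diag_iso.single)
  next
    case False
    then show ?thesis using Cons a by (auto simp: diagrams_def intro: diag_iso.cons)
  qed
qed (simp add: diagrams_def)

text \<open>The move \<open>iso\<close> concerns the whole diagram and is prolonged by identity
  squares along \<open>c\<close>; every other move carries a context that absorbs
  \<open>c\<close>.\<close>

lemma diag_move_append:
  assumes "diag_move S T d d'" "c \<in> diagrams T U"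
  shows "diag_move S U (d @ c) (d' @ c)"
  using assms(1)
proof cases
  case iso
  then show ?thesis
    using diag_iso_append[OF _ diag_iso_id[OF assms(2)]] by (auto intro: diag_move.iso)
next
  case (ident_T d e A)
  then show ?thesis using diag_move.ident_T[of S U d "e @ c" A] by simp
next
  case (ident_R d e A)
  then show ?thesis using diag_move.ident_R[of S U d "e @ c" A] by simp
next
  case (comp_T d A B f C g e)
  then show ?thesis using diag_move.comp_T[of S U d A B f C g "e @ c"] by simp
next
  case (comp_R d B C g A f e)
  then show ?thesis using diag_move.comp_R[of S U d B C g A f "e @ c"] by simp
next
  case (exchange P B C A f g p d e)
  then show ?thesis using diag_move.exchange[of P B C A f g p S U d "e @ c"] by simp
qed

lemma diag_move_prepend:
  assumes "diag_move T U d d'" "c \<in> diagrams S T"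
  shows "diag_move S U (c @ d) (c @ d')"
  using assms(1)
proof cases
  case iso
  then show ?thesis
    using diag_iso_append[OF diag_iso_id[OF assms(2)]] by (auto intro: diag_move.iso)
next
  case (ident_T d e A)
  then show ?thesis using diag_move.ident_T[of S U "c @ d" e A] by simp
next
  case (ident_R d e A)
  then show ?thesis using diag_move.ident_R[of S U "c @ d" e A] by simp
next
  case (comp_T d A B f C g e)
  then show ?thesis using diag_move.comp_T[of S U "c @ d" A B f C g e] by simp
next
  case (comp_R d B C g A f e)
  then show ?thesis using diag_move.comp_R[of S U "c @ d" B C g A f e] by simp
next
  case (exchange P B C A f g p d e)
  then show ?thesis using diag_move.exchange[of P B C A f g p S U "c @ d" e] by simp
qed

lemma equivclp_map:
  assumes "equivclp R x y" "\<And>x y. R x y \<Longrightarrow> R' (h x) (h y)"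
  shows "equivclp R' (h x) (h y)"
  using assms(1)
proof (induction rule: equivclp_induct)
  case (step y z)
  then show ?case using assms(2) by (blast intro: equivclp_into_equivclp)
qed simp

lemma diag_rel_append:
  assumes d: "(d, d') \<in> diag_rel S T" and e: "(e, e') \<in> diag_rel T U"
  shows "(d @ e, d' @ e') \<in> diag_rel S U"
proof (rule diag_rel_trans)
  let ?R = "\<lambda>S T x y. x \<in> diagrams S T \<and> y \<in> diagrams S T \<and> diag_move S T x y"
  have dd: "d \<in> diagrams S T" "d' \<in> diagrams S T" "equivclp (?R S T) d d'"
    and ee: "e \<in> diagrams T U" "e' \<in> diagrams T U" "equivclp (?R T U) e e'"
    using d e by (auto simp: diag_rel_def)
  have "equivclp (?R S U) (d @ e) (d' @ e)"
    by (rule equivclp_map[OF dd(3), where h = "\<lambda>x. x @ e"])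
      (use ee in \<open>auto intro: diagrams_append diag_move_append\<close>)
  then show "(d @ e, d' @ e) \<in> diag_rel S U"
    using dd ee by (auto simp: diag_rel_def diagrams_append)
  have "equivclp (?R S U) (d' @ e) (d' @ e')"
    by (rule equivclp_map[OF ee(3), where h = "\<lambda>x. d' @ x"])
      (use dd in \<open>auto intro: diagrams_append diag_move_prepend\<close>)
  then show "(d' @ e, d' @ e') \<in> diag_rel S U"
    using dd ee by (auto simp: diag_rel_def diagrams_append)
qed

lemma Hom_TP_TR: "Hom TP_TR S T = diag_class S T ` diagrams S T"
  by (auto simp: TP_TR_def quotient_def diag_class_def)

lemma Obj_TP_TR: "Obj TP_TR = {S. truncation_poset S}"
  by (simp add: TP_TR_def)

lemma Ident_TP_TR: "Ident TP_TR S = diag_class S S [TArr S S (tp_id S)]"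
  by (simp add: TP_TR_def)

lemma Comp_TP_TR:
  assumes "d \<in> diagrams S T" "e \<in> diagrams T U"
  shows "Comp TP_TR S T U (diag_class T U e) (diag_class S T d) = diag_class S U (d @ e)"
proof -
  have "diag_class S U (d' @ e') = diag_class S U (d @ e)"
    if "d' \<in> diag_class S T d" "e' \<in> diag_class T U e" for d' e'
  proof -
    have "(d, d') \<in> diag_rel S T" "(e, e') \<in> diag_rel T U"
      using that by (auto simp: diag_class_def)
    then show ?thesis by (intro diag_class_eqI[symmetric] diag_rel_append)
  qed
  then have "(\<Union>d'\<in>diag_class S T d. \<Union>e'\<in>diag_class T U e. diag_class S U (d' @ e')) =
      (\<Union>d'\<in>diag_class S T d. \<Union>e'\<in>diag_class T U e. diag_class S U (d @ e))"
    by simp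
  moreover have "d \<in> diag_class S T d" "e \<in> diag_class T U e"
    using assms by (auto simp: diag_class_def diag_rel_def)
  ultimately show ?thesis
    by (auto simp: TP_TR_def)
qed

section \<open>Identities and composites of R-maps and T-maps\<close>

lemma rmap_id: "truncation_poset S \<Longrightarrow> rmap S S (tp_id S)"
  by (rule tp_iso_rmap[OF tp_iso_id])

lemma tmap_id:
  assumes "truncation_poset S"
  shows "tmap S S (tp_id S)"
proof -
  have "{s \<in> pts S. tp_id S s = t} \<subseteq> {t}" for t
    by (auto simp: tp_id_def)
  then have "finite {s \<in> pts S. tp_id S s = t}" for t
    using finite_subset by blast
  then show ?thesis
    using rmap_id[OF assms] by (auto simp: tmap_def) (auto simp: tp_id_def)
qed

lemma rmap_comp:
  assumes "truncation_poset S" and f: "rmap S T f" and g: "rmap T U g"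
  shows "rmap S U (compose (pts S) g f)"
proof -
  interpret tposet S by standard fact
  have "compose (pts S) g f \<in> pts S \<rightarrow>\<^sub>E pts U"
    using f g by (auto simp: rmap_pts compose_def)
  moreover have "(g (f s), g (f t)) \<in> rel U \<and>
      nrm U (g (f t)) div nrm U (g (f s)) = nrm S t div nrm S s" if "(s, t) \<in> rel S" for s t
    using f g that unfolding rmap_def by fastforce
  ultimately show ?thesis
    using rel_pts by (auto simp: rmap_def compose_def)
qed

lemma tmap_comp:
  assumes S: "truncation_poset S" and f: "tmap S T f" and g: "tmap T U g"
  shows "tmap S U (compose (pts S) g f)"
  unfolding tmap_def
proof (intro conjI ballI impI)
  have f': "rmap S T f" and g': "rmap T U g" using f g by (auto simp: tmap_def)
  show "rmap S U (compose (pts S) g f)" by (rule rmap_comp[OF S f' g'])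
  fix s u assume s: "s \<in> pts S" and u: "u \<in> pts U" and su: "(compose (pts S) g f s, u) \<in> rel U"
  obtain t where t: "t \<in> pts T" "(f s, t) \<in> rel T" "g t = u"
    using g u su s rmap_pts[OF f' s] unfolding tmap_def by (auto simp: compose_def)
  then obtain s' where "s' \<in> pts S" "(s, s') \<in> rel S" "f s' = t"
    using f s unfolding tmap_def by blast
  with t(3) show "\<exists>s'\<in>pts S. (s, s') \<in> rel S \<and> compose (pts S) g f s' = u"
    by (auto simp: compose_def)
next
  fix u assume u: "u \<in> pts U"
  have "{s \<in> pts S. compose (pts S) g f s = u} \<subseteq>
      (\<Union>t\<in>{t \<in> pts T. g t = u}. {s \<in> pts S. f s = t})"
    using f by (auto simp: compose_def tmap_def rmap_pts)
  moreover have "finite (\<Union>t\<in>{t \<in> pts T. g t = u}. {s \<in> pts S. f s = t})"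
    using f g u by (auto simp: tmap_def)
  ultimately show "finite {s \<in> pts S. compose (pts S) g f s = u}"
    by (rule finite_subset)
qed

lemma rmap_funcset: "rmap S T f \<Longrightarrow> f \<in> pts S \<rightarrow>\<^sub>E pts T"
  by (simp add: rmap_def)

lemma rmap_compose_id:
  assumes "rmap S T f"
  shows "compose (pts S) f (tp_id S) = f" "compose (pts S) (tp_id T) f = f"
  using rmap_funcset[OF assms] unfolding tp_id_def PiE_def
  by (auto intro: compose_Id Id_compose)

lemma rmap_compose_assoc:
  assumes "rmap S T f"
  shows "compose (pts S) h (compose (pts S) g f) = compose (pts S) (compose (pts T) h g) f"
  using rmap_funcset[OF assms] by (intro compose_assoc) auto

lemma category_TP_R: "is_category TP_R"
  unfolding is_category_def TP_R_def
  by (simp add: rmap_id rmap_comp rmap_compose_id rmap_compose_assoc)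

lemma category_TP_T: "is_category TP_T"
proof -
  have rmap: "rmap S T f" if "tmap S T f" for S T :: "'a tposet" and f
    using that by (simp add: tmap_def)
  show ?thesis
    unfolding is_category_def TP_T_def
    by (simp add: tmap_id tmap_comp rmap_compose_id[OF rmap] rmap_compose_assoc[OF rmap])
qed

lemma category_op: "is_category C \<Longrightarrow> is_category (op_cat C)"
  by (simp add: is_category_def op_cat_def)

lemma category_set: "is_category set_cat"
  unfolding is_category_def set_cat_def
proof (simp, intro conjI allI ballI)
  fix A B :: "'a set" and f assume f: "f \<in> A \<rightarrow>\<^sub>E B"
  then show "compose A f (\<lambda>x\<in>A. x) = f" "compose A (\<lambda>x\<in>B. x) f = f"
    by (auto simp: PiE_def intro: compose_Id Id_compose)
  fix D g assume g: "g \<in> B \<rightarrow>\<^sub>E D"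
  with f show "compose A g f \<in> A \<rightarrow>\<^sub>E D"
    by (auto simp: compose_def)
  show "compose A h (compose A g f) = compose A (compose B h g) f" for h
    using f by (intro compose_assoc) auto
qed

lemma TArr_diagram: "truncation_poset S \<Longrightarrow> truncation_poset T \<Longrightarrow> tmap S T f \<Longrightarrow> [TArr S T f] \<in> diagrams S T"
  by (simp add: diagrams_def)

lemma RArr_diagram: "truncation_poset S \<Longrightarrow> truncation_poset T \<Longrightarrow> rmap S T f \<Longrightarrow> [RArr S T f] \<in> diagrams T S"
  by (simp add: diagrams_def)

text \<open>Associativity is that of concatenation; the unit laws are the move
  \<open>ident_T\<close>.\<close>

lemma category_TP_TR: "is_category (TP_TR :: ('u tposet, _) cat)"
proof -
  have ident: "diag_class S T (d @ [TArr T T (tp_id T)]) = diag_class S T d"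
    "diag_class S T ([TArr S S (tp_id S)] @ d) = diag_class S T d"
    if d: "d \<in> diagrams S T" for S T :: "'u tposet" and d
  proof -
    note tp = diagrams_tposet[OF d]
    note t = TArr_diagram[OF tp(1) tp(1) tmap_id[OF tp(1)]] TArr_diagram[OF tp(2) tp(2) tmap_id[OF tp(2)]]
    show "diag_class S T (d @ [TArr T T (tp_id T)]) = diag_class S T d"
      using diag_move.ident_T[of S T d "[]" T] diagrams_append[OF d t(2)] d
      by (intro diag_class_move[symmetric]) simp_all
    show "diag_class S T ([TArr S S (tp_id S)] @ d) = diag_class S T d"
      using diag_move.ident_T[of S T "[]" d S] diagrams_append[OF t(1) d] d
      by (intro diag_class_move[symmetric]) simp_all
  qed
  show ?thesis
    unfolding is_category_def Obj_TP_TR Hom_TP_TR Ident_TP_TR mem_Collect_eq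
    by (auto simp: Comp_TP_TR TArr_diagram tmap_id diagrams_append ident simp del: append_Cons)
qed

lemma functor_incl_T: "is_functor TP_T TP_TR incl_T"
proof -
  have comp: "diag_class S U ([TArr S T f] @ [TArr T U g]) =
      diag_class S U [TArr S U (compose (pts S) g f)]"
    if "truncation_poset S" "truncation_poset T" "truncation_poset U" "tmap S T f" "tmap T U g"
    for S T U :: "'a tposet" and f g
  proof (rule diag_class_move)
    show "[TArr S T f] @ [TArr T U g] \<in> diagrams S U"
      using that by (simp add: diagrams_def)
    show "[TArr S U (compose (pts S) g f)] \<in> diagrams S U"
      using that by (simp add: diagrams_def tmap_comp)
    show "diag_move S U ([TArr S T f] @ [TArr T U g]) [TArr S U (compose (pts S) g f)]"
      using diag_move.comp_T[of S U "[]" S T f U g "[]"] by simp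
  qed
  show ?thesis
    unfolding is_functor_def Obj_TP_TR Hom_TP_TR Ident_TP_TR
    by (intro conjI category_TP_T category_TP_TR)
      (simp_all add: TP_T_def incl_T_def Comp_TP_TR TArr_diagram comp[unfolded append_Cons append_Nil])
qed

lemma functor_incl_R: "is_functor (op_cat TP_R) TP_TR incl_R"
proof -
  have comp: "diag_class U S ([RArr T U g] @ [RArr S T f]) =
      diag_class U S [RArr S U (compose (pts S) g f)]"
    if "truncation_poset S" "truncation_poset T" "truncation_poset U" "rmap S T f" "rmap T U g"
    for S T U :: "'a tposet" and f g
  proof (rule diag_class_move)
    show "[RArr T U g] @ [RArr S T f] \<in> diagrams U S"
      using that by (simp add: diagrams_def)
    show "[RArr S U (compose (pts S) g f)] \<in> diagrams U S"
      using that by (simp add: diagrams_def rmap_comp)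
    show "diag_move U S ([RArr T U g] @ [RArr S T f]) [RArr S U (compose (pts S) g f)]"
      using diag_move.comp_R[of U S "[]" T U g S f "[]"] by simp
  qed
  \<comment> \<open>The identity of \<open>TP_TR\<close> is represented by a T-arrow. The diagram
    \<open>[?t, ?r]\<close> arises from either identity arrow by inserting the other, so the two
    classes coincide.\<close>
  have ident: "diag_class S S [RArr S S (tp_id S)] = diag_class S S [TArr S S (tp_id S)]"
    if S: "truncation_poset S" for S :: "'a tposet"
  proof -
    let ?t = "TArr S S (tp_id S)" and ?r = "RArr S S (tp_id S)"
    have d: "[?t] \<in> diagrams S S" "[?r] \<in> diagrams S S" "[?t, ?r] \<in> diagrams S S"
      using S by (simp_all add: diagrams_def tmap_id rmap_id)
    have "diag_class S S [?r] = diag_class S S [?t, ?r]"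
      using diag_move.ident_T[of S S "[]" "[?r]" S] d by (intro diag_class_move) simp_all
    also have "\<dots> = diag_class S S [?t]"
      using diag_move.ident_R[of S S "[?t]" "[]" S] d by (intro diag_class_move[symmetric]) simp_all
    finally show ?thesis .
  qed
  show ?thesis
    unfolding is_functor_def Obj_TP_TR Hom_TP_TR Ident_TP_TR
    by (intro conjI category_op category_TP_R category_TP_TR)
      (simp_all add: TP_R_def op_cat_def incl_R_def Comp_TP_TR RArr_diagram ident
        comp[unfolded append_Cons append_Nil])
qed

lemma functor_comp:
  "is_functor C D F \<Longrightarrow> is_functor D E G \<Longrightarrow> is_functor C E (fctr_comp G F)"
  unfolding is_functor_def fctr_comp_def by auto

text \<open>Functoriality of \<open>G\<close> is inherited from \<open>F\<close>; in this way
  \<open>witt_star k\<close> and \<open>witt_oplus k\<close> become functors through their agreement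
  with composites via \<open>TP_TR\<close>.\<close>

lemma same_functorI:
  assumes F: "is_functor C D F"
    and obj: "\<And>A. A \<in> Obj C \<Longrightarrow> fobj F A = fobj G A"
    and arr: "\<And>A B f. A \<in> Obj C \<Longrightarrow> B \<in> Obj C \<Longrightarrow> f \<in> Hom C A B \<Longrightarrow> farr F A B f = farr G A B f"
  shows "same_functor C D F G"
proof -
  have C: "is_category C"
    using F by (simp add: is_functor_def)
  have "Ident C A \<in> Hom C A A" if "A \<in> Obj C" for A
    using C that by (simp add: is_category_def)
  moreover have "Comp C A B E g f \<in> Hom C A E"
    if "A \<in> Obj C" "B \<in> Obj C" "E \<in> Obj C" "f \<in> Hom C A B" "g \<in> Hom C B E" for A B E f g
    using C that by (simp add: is_category_def)
  ultimately have "is_functor C D G"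
    using F unfolding is_functor_def by (simp add: obj[symmetric] arr[symmetric])
  then show ?thesis
    using F obj arr by (simp add: same_functor_def)
qed

theorem theorem4p6:
  fixes k :: "'r ring"
  assumes "infinite (UNIV :: 'u set)"
    and "infinite (UNIV :: 'r set)"
    and "cring k"
  shows "is_functor (op_cat TP_R) TP_TR (incl_R :: ('u tposet, _, _, _) fctr) \<and>
    is_functor TP_T TP_TR (incl_T :: ('u tposet, _, _, _) fctr) \<and>
    (\<exists>W :: ('u tposet, 'u arrow list set, ('u \<Rightarrow> 'r) set, ('u \<Rightarrow> 'r) \<Rightarrow> ('u \<Rightarrow> 'r)) fctr.
       is_functor TP_TR set_cat W \<and>
       (\<forall>S \<in> Obj TP_TR. fobj W S = witt S k) \<and>
       same_functor (op_cat TP_R) set_cat (fctr_comp W incl_R) (witt_star k) \<and>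
       same_functor TP_T set_cat (fctr_comp W incl_T) (witt_oplus k))"
proof -
  note inf = assms(2) and k = assms(3)
  \<comment> \<open>A morphism is a set of diagrams, so a representative is picked;
    \<open>diagram_map_cong\<close> makes the choice immaterial.\<close>
  define W :: "('u tposet, 'u arrow list set, ('u \<Rightarrow> 'r) set, ('u \<Rightarrow> 'r) \<Rightarrow> ('u \<Rightarrow> 'r)) fctr" where
    "W = \<lparr>fobj = (\<lambda>S. witt S k), farr = (\<lambda>S T F. diagram_map S (SOME d. d \<in> F) k)\<rparr>"
  have obj: "fobj W S = witt S k" for S
    by (simp add: W_def)
  have arr: "farr W S T (diag_class S T d) = diagram_map S d k"
    if "d \<in> diagrams S T" for S T :: "'u tposet" and d
  proof -
    have "d \<in> diag_class S T d"
      using that by (auto simp: diag_class_def diag_rel_def)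
    then have "(SOME e. e \<in> diag_class S T d) \<in> diag_class S T d"
      by (rule someI)
    then have "(d, SOME e. e \<in> diag_class S T d) \<in> diag_rel S T"
      by (simp add: diag_class_def)
    from diagram_map_cong[OF inf k this] show ?thesis
      by (simp add: W_def)
  qed
  have ident: "diagram_map S [TArr S S (tp_id S)] k = (\<lambda>a\<in>witt S k. a)"
    if S: "truncation_poset S" for S :: "'u tposet"
  proof -
    \<comment> \<open>The map induced by the identity is described only by its effect on ghost
      vectors, so uniqueness of lifts has to identify it.\<close>
    have "oplus_map S S (tp_id S) = (\<lambda>k\<in>{k :: 'r ring. cring k}. \<lambda>a\<in>witt S k. a)"
      using S by (intro lifts_unique[OF inf S t_map.oplus_map_lifts[OF t_mapI inf] lifts_id])
        (auto simp: tmap_id ghost_oplus_id)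
    then show ?thesis
      using diagram_map_single[OF inf k, of "TArr S S (tp_id S)"] S k by (simp add: tmap_id)
  qed
  have W: "is_functor TP_TR set_cat W"
    unfolding is_functor_def Obj_TP_TR Hom_TP_TR Ident_TP_TR
  proof (intro conjI category_TP_TR category_set)
    show "\<forall>S\<in>{S. truncation_poset S}. fobj W S \<in> Obj set_cat"
      by (simp add: set_cat_def)
    show "\<forall>S\<in>{S. truncation_poset S}. \<forall>T\<in>{S. truncation_poset S}.
        \<forall>f\<in>diag_class S T ` diagrams S T. farr W S T f \<in> Hom set_cat (fobj W S) (fobj W T)"
      using diagram_map_witt[OF inf _ k] by (auto simp: arr obj set_cat_def diagrams_def)
    show "\<forall>S\<in>{S. truncation_poset S}.
        farr W S S (diag_class S S [TArr S S (tp_id S)]) = Ident set_cat (fobj W S)"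
      by (simp add: arr obj ident TArr_diagram tmap_id set_cat_def del: diagram_map.simps)
    show "\<forall>S\<in>{S. truncation_poset S}. \<forall>T\<in>{S. truncation_poset S}. \<forall>U\<in>{S. truncation_poset S}.
        \<forall>f\<in>diag_class S T ` diagrams S T. \<forall>g\<in>diag_class T U ` diagrams T U.
        farr W S U (Comp TP_TR S T U g f) =
        Comp set_cat (fobj W S) (fobj W T) (fobj W U) (farr W T U g) (farr W S T f)"
      using diagram_map_append[OF inf k]
      by (auto simp: Comp_TP_TR arr obj diagrams_append set_cat_def) (auto simp: diagrams_def)
  qed
  have "same_functor (op_cat TP_R) set_cat (fctr_comp W incl_R) (witt_star k)"
  proof (rule same_functorI[OF functor_comp[OF functor_incl_R W]])
    fix T S :: "'u tposet" and f
    assume "T \<in> Obj (op_cat TP_R)" "S \<in> Obj (op_cat TP_R)" "f \<in> Hom (op_cat TP_R) T S"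
    then have ok: "arrow_ok (RArr S T f)"
      by (simp add: op_cat_def TP_R_def)
    then show "farr (fctr_comp W incl_R) T S f = farr (witt_star k) T S f"
      using diagram_map_single[OF inf k ok]
      by (simp add: fctr_comp_def incl_R_def witt_star_def arr RArr_diagram)
  qed (simp add: fctr_comp_def incl_R_def witt_star_def obj)
  moreover have "same_functor TP_T set_cat (fctr_comp W incl_T) (witt_oplus k)"
  proof (rule same_functorI[OF functor_comp[OF functor_incl_T W]])
    fix S T :: "'u tposet" and f
    assume "S \<in> Obj TP_T" "T \<in> Obj TP_T" "f \<in> Hom TP_T S T"
    then have ok: "arrow_ok (TArr S T f)"
      by (simp add: TP_T_def)
    then show "farr (fctr_comp W incl_T) S T f = farr (witt_oplus k) S T f"
      using diagram_map_single[OF inf k ok]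
      by (simp add: fctr_comp_def incl_T_def witt_oplus_def arr TArr_diagram)
  qed (simp add: fctr_comp_def incl_T_def witt_oplus_def obj)
  ultimately show ?thesis
    using functor_incl_R functor_incl_T W obj by blast
qed

end
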